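(* Let $n\ge 2$ and $M\ge 0$. There exists a constant $\alpha>0$ depending only on $n$ and $M$, with $\alpha=1$ when $M=0$, such that the following holds. Let $x_0\in\mathbb{R}^n$, $0<r\le 1$, and let $\vec b:B_r(x_0)\to\mathbb{R}^n$ and $c:B_r(x_0)\to\mathbb{R}$ satisfy $\|\vec b\|_{C^1(B_r(x_0))}\le M$ and $c(x)\le M$ in $B_r(x_0)$. Let $m>0$ and let $u\in L^1_{\rm loc}(B_r(x_0)\setminus\{x_0\})$ satisfy $$\begin{cases}-\Delta u+\vec b\cdot\nabla u+c\,u\ge 0 & \text{in }\mathcal{D}'(B_r(x_0)\setminus\{x_0\}),\\ u\ge m & \text{in }B_r(x_0)\setminus B_{r/2}(x_0),\\ u\ge 0 & \text{in }B_r(x_0).\end{cases}$$ Then $u\ge \alpha m$ in $B_r(x_0)$.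
   Context: $B_r(x_0)$ is the open ball of radius $r$ centered at $x_0$. Pointwise inequalities for $u$ are understood almost everywhere. The function $c$ is measurable and such that $cu$ is locally integrable on $B_r(x_0)\setminus\{x_0\}$, so that the differential inequality makes sense. For an open set $U$, $-\Delta u+\vec b\cdot\nabla u+cu\ge 0$ in $\mathcal{D}'(U)$ means $\int_U u\,[-\Delta\varphi-\mathrm{div}(\vec b\,\varphi)+c\,\varphi]\,dx\ge 0$ for every nonnegative $\varphi\in C_c^\infty(U)$. *)

theory Defs
  imports "HOL-Analysis.Analysis"
begin

definition partial_deriv :: "'n::finite \<Rightarrow> (real ^ 'n \<Rightarrow> 'b::real_normed_vector) \<Rightarrow> real ^ 'n \<Rightarrow> 'b" where
  "partial_deriv i f x = frechet_derivative f (at x) (axis i 1)"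

text \<open>
  Functions of class \<open>C\<^sup>k\<close>. The set \<open>U\<close> is meant to be open; differentiability is Frechet
  differentiability at each point of \<open>U\<close>, so values of \<open>f\<close> outside \<open>U\<close> play no role.
\<close>

primrec Ck_on :: "nat \<Rightarrow> (real ^ 'n::finite) set \<Rightarrow> (real ^ 'n \<Rightarrow> 'b::real_normed_vector) \<Rightarrow> bool" where
  "Ck_on 0 U f \<longleftrightarrow> continuous_on U f"
| "Ck_on (Suc k) U f \<longleftrightarrow>
     (\<forall>x\<in>U. f differentiable (at x)) \<and> (\<forall>i. Ck_on k U (partial_deriv i f))"

text \<open>
  The norm \<open>sup \<bar>f\<bar> + sup \<bar>D f\<bar>\<close> over \<open>U\<close>, where \<open>\<bar>D f\<bar>\<close> is the operator norm of the Jacobian.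
  It is extended-valued so that it is infinite, rather than unspecified, when \<open>f\<close> or \<open>D f\<close> is
  unbounded.
\<close>

definition C1_norm :: "(real ^ 'n::finite) set \<Rightarrow> (real ^ 'n \<Rightarrow> real ^ 'n) \<Rightarrow> ennreal" where
  "C1_norm U f = (SUP x\<in>U. ennreal (norm (f x)))
               + (SUP x\<in>U. ennreal (onorm (frechet_derivative f (at x))))"

definition laplacian :: "(real ^ 'n::finite \<Rightarrow> real) \<Rightarrow> real ^ 'n \<Rightarrow> real" where
  "laplacian f x = (\<Sum>i\<in>UNIV. partial_deriv i (partial_deriv i f) x)"

definition divergence :: "(real ^ 'n::finite \<Rightarrow> real ^ 'n) \<Rightarrow> real ^ 'n \<Rightarrow> real" where
  "divergence F x = (\<Sum>i\<in>UNIV. partial_deriv i (\<lambda>y. F y $ i) x)"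

text \<open>
  \<open>C\<^sub>c\<^sup>\<infinity>(U)\<close>, its elements being extended by zero to the whole space.
\<close>

definition test_function :: "(real ^ 'n::finite) set \<Rightarrow> (real ^ 'n \<Rightarrow> real) \<Rightarrow> bool" where
  "test_function U \<phi> \<longleftrightarrow>
     (\<forall>k. Ck_on k UNIV \<phi>) \<and>
     compact (closure {x. \<phi> x \<noteq> 0}) \<and> closure {x. \<phi> x \<noteq> 0} \<subseteq> U"

definition locally_integrable_on :: "(real ^ 'n::finite \<Rightarrow> real) \<Rightarrow> (real ^ 'n) set \<Rightarrow> bool"
    (infixr "locally'_integrable'_on" 46) where
  "u locally_integrable_on U \<longleftrightarrow>
     (\<forall>K. compact K \<and> K \<subseteq> U \<longrightarrow> u absolutely_integrable_on K)"

text \<open>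
  \<open>- \<Delta>u + b \<cdot> \<nabla>u + c u \<ge> 0\<close> in the sense of distributions on \<open>U\<close>. Only meaningful when \<open>U\<close> is
  open, \<open>b\<close> is \<open>C\<^sup>1\<close> on \<open>U\<close>, and \<open>u\<close> and \<open>c u\<close> are locally integrable on \<open>U\<close>: the integrand is
  then integrable, so the default value of the Bochner integral never enters.
\<close>

definition distributional_supersolution ::
    "(real ^ 'n::finite) set \<Rightarrow> (real ^ 'n \<Rightarrow> real ^ 'n) \<Rightarrow> (real ^ 'n \<Rightarrow> real) \<Rightarrow> (real ^ 'n \<Rightarrow> real) \<Rightarrow> bool"
  where
  "distributional_supersolution U b c u \<longleftrightarrow>
     (\<forall>\<phi>. test_function U \<phi> \<and> (\<forall>x. 0 \<le> \<phi> x) \<longrightarrow>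
        0 \<le> (LINT x:U|lebesgue.
               u x * (- laplacian \<phi> x - divergence (\<lambda>y. \<phi> y *\<^sub>R b y) x + c x * \<phi> x)))"

end

theory Submission
  imports Defs
begin

text \<open>
  The proof is by duality and never regularises \<open>u\<close>: for almost every \<open>y\<close> one explicit
  test function converts the differential inequality into a lower bound for the averages of \<open>u\<close>
  over small balls around \<open>y\<close>.

  Since \<open>u \<ge> 0\<close> and \<open>c \<le> M\<close>, the potential \<open>c\<close> may be replaced by the constant \<open>M\<close>. Because
  \<open>u \<ge> 0\<close>, a test function \<open>\<phi>\<close> is useful as soon as the adjoint operator
  \<open>A = - \<Delta>\<phi> - div(\<phi> b) + M \<phi>\<close> satisfies a one-sided bound: if
  \<open>A \<le> C s\<^sup>-\<^sup>n\<close> on \<open>B\<^sub>s(y)\<close>, \<open>A \<le> - g\<close> on some ball inside the outer shell where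
  \<open>u \<ge> m\<close>, and \<open>A \<le> 0\<close> elsewhere, then \<open>0 \<le> \<integral> u A\<close> says that the average of \<open>u\<close> over
  \<open>B\<^sub>s(y)\<close> is at least a multiple of \<open>m\<close> that does not depend on \<open>s\<close> or \<open>y\<close>.

  Such a \<open>\<phi>\<close> is \<open>F(w)\<close> with \<open>w = \<Psi>(\<bar>x - y\<bar>\<^sup>2 + s\<^sup>2) - \<delta> G(\<bar>x - x0\<bar>\<^sup>2) - const\<close>. Here \<open>\<Psi>\<close> is a
  perturbation of the fundamental solution, smoothed at scale \<open>s\<close>, whose perturbation factors
  beat the drift and the potential outside \<open>B\<^sub>s(y)\<close>. The function \<open>G\<close> is a supersolution with a
  logarithmic pole; it exists because points have zero capacity for \<open>n \<ge> 2\<close>, and it forces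
  \<open>w \<le> 0\<close> near \<open>x0\<close>, so the puncture is never seen. Finally \<open>F(t) = t e\<^sup>-\<^sup>1\<^sup>/\<^sup>t\<close> is a smooth convex
  substitute for the positive part. Convexity has the good sign twice: it keeps \<open>F(w)\<close> a
  subsolution, and its term \<open>F''(w) \<bar>\<nabla>w\<bar>\<^sup>2\<close> produces the gain \<open>g\<close> in the outer shell. All this is
  \<open>barrier_test_function\<close>. The Vitali covering theorem
  (\<open>AE_nonneg_of_ball_integrals\<close>) turns the bounds on averages into \<open>u \<ge> \<alpha> m\<close> almost everywhere,
  with some \<open>\<alpha> \<in> (0, 1/2]\<close> depending on \<open>n\<close> and \<open>M\<close> only (\<open>lower_bound\<close>).

  For \<open>M = 0\<close> the drift vanishes, so constants may be subtracted from \<open>u\<close>. Applying the lossy bound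
  repeatedly to \<open>u - a\<close>, where \<open>a\<close> is the bound already known, closes a fixed fraction of the gap
  to \<open>m\<close> each time, and in the limit \<open>\<alpha> = 1\<close> (\<open>sharp_lower_bound\<close>).
\<close>

section \<open>Calculus of partial derivatives and of the classes \<open>C\<^sup>k\<close>\<close>

lemma partial_deriv_eq:
  "(f has_derivative f') (at x) \<Longrightarrow> partial_deriv i f x = f' (axis i 1)"
  unfolding partial_deriv_def by (metis frechet_derivative_at)

lemma has_derivative_cong_open:
  assumes "open U" "x \<in> U" "\<And>y. y \<in> U \<Longrightarrow> f y = g y"
  shows "(f has_derivative f') (at x) \<longleftrightarrow> (g has_derivative f') (at x)"
  using assms has_derivative_transform_within_open[of f f' x UNIV U g]
    has_derivative_transform_within_open[of g f' x UNIV U f] by auto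

lemma partial_deriv_cong:
  assumes "open U" "x \<in> U" "\<And>y. y \<in> U \<Longrightarrow> f y = g y"
  shows "partial_deriv i f x = partial_deriv i g x"
  unfolding partial_deriv_def frechet_derivative_def
  using has_derivative_cong_open[OF assms] by simp

lemma differentiable_cong_open:
  assumes "open U" "x \<in> U" "\<And>y. y \<in> U \<Longrightarrow> f y = g y"
  shows "f differentiable (at x) \<longleftrightarrow> g differentiable (at x)"
  unfolding differentiable_def using has_derivative_cong_open[OF assms] by simp

lemma Ck_on_cong:
  assumes "open U" "\<And>y. y \<in> U \<Longrightarrow> f y = g y"
  shows "Ck_on k U f \<longleftrightarrow> Ck_on k U g"
  using assms(2)
proof (induction k arbitrary: f g)
  case 0
  then show ?case by (auto cong: continuous_on_cong)
next
  case (Suc k)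
  have "f differentiable (at x) \<longleftrightarrow> g differentiable (at x)" if "x \<in> U" for x
    using differentiable_cong_open[OF assms(1) that, of f g] Suc.prems by blast
  moreover have "Ck_on k U (partial_deriv i f) \<longleftrightarrow> Ck_on k U (partial_deriv i g)" for i
    by (rule Suc.IH) (rule partial_deriv_cong[OF assms(1) _ Suc.prems])
  ultimately show ?case by simp
qed

lemma Ck_on_continuous: "Ck_on k U f \<Longrightarrow> continuous_on U f"
  by (cases k) (auto intro!: continuous_at_imp_continuous_on differentiable_imp_continuous_within)

lemma Ck_on_SucD: "Ck_on (Suc k) U f \<Longrightarrow> Ck_on k U f"
proof (induction k arbitrary: f)
  case 0
  then show ?case using Ck_on_continuous by (metis Ck_on.simps(1))
qed auto

lemma Ck_on_const: "Ck_on k U (\<lambda>x::real^'n::finite. c)"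
proof (induction k arbitrary: c)
  case (Suc k)
  have "partial_deriv i (\<lambda>x::real^'n. c) = (\<lambda>x. 0)" for i
    by (rule ext, subst partial_deriv_eq[OF has_derivative_const]) simp
  then show ?case using Suc by simp
qed simp

lemma Ck_on_component: "Ck_on k U (\<lambda>x::real^'n::finite. x $ j)"
proof (cases k)
  case (Suc l)
  have d: "((\<lambda>x::real^'n. x $ j) has_derivative (\<lambda>x. x $ j)) (at x)" for x
    by (rule bounded_linear_imp_has_derivative[OF bounded_linear_vec_nth])
  have "partial_deriv i (\<lambda>x::real^'n. x $ j) = (\<lambda>x. axis i 1 $ j)" for i
    by (rule ext, subst partial_deriv_eq[OF d]) simp
  then show ?thesis using Suc d by (auto simp: differentiable_def Ck_on_const)
qed (auto intro: continuous_intros)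

lemma partial_deriv_add:
  assumes "f differentiable (at x)" "g differentiable (at x)"
  shows "partial_deriv i (\<lambda>y. f y + g y) x = partial_deriv i f x + partial_deriv i g x"
  using partial_deriv_eq[OF has_derivative_add[OF assms[unfolded frechet_derivative_works]]]
  by (simp add: partial_deriv_def)

lemma partial_deriv_mult:
  fixes f g :: "real ^ 'n::finite \<Rightarrow> real"
  assumes "f differentiable (at x)" "g differentiable (at x)"
  shows "partial_deriv i (\<lambda>y. f y * g y) x = f x * partial_deriv i g x + partial_deriv i f x * g x"
  using partial_deriv_eq[OF has_derivative_mult[OF assms[unfolded frechet_derivative_works]]]
  by (simp add: partial_deriv_def)

lemma has_derivative_compose_real:
  assumes "f differentiable (at x)" "(g has_real_derivative g') (at (f x))"
  shows "((\<lambda>y. g (f y)) has_derivative (\<lambda>h. g' * frechet_derivative f (at x) h)) (at x)"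
  using has_derivative_compose[OF assms(1)[unfolded frechet_derivative_works]
      assms(2)[unfolded has_field_derivative_def]] .

lemma partial_deriv_compose:
  assumes "f differentiable (at x)" "(g has_real_derivative g') (at (f x))"
  shows "partial_deriv i (\<lambda>y. g (f y)) x = g' * partial_deriv i f x"
  using partial_deriv_eq[OF has_derivative_compose_real[OF assms]] by (simp add: partial_deriv_def)

lemma Ck_on_add:
  assumes "open U" "Ck_on k U f" "Ck_on k U g"
  shows "Ck_on k U (\<lambda>x. f x + g x)"
  using assms(2,3)
proof (induction k arbitrary: f g)
  case (Suc k)
  have "Ck_on k U (partial_deriv i (\<lambda>x. f x + g x))" for i
    by (subst Ck_on_cong[OF assms(1), where g = "\<lambda>x. partial_deriv i f x + partial_deriv i g x"])
       (use Suc in \<open>auto intro!: partial_deriv_add\<close>)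
  then show ?case using Suc.prems by auto
qed (auto intro: continuous_intros)

lemma Ck_on_mult:
  fixes f g :: "real ^ 'n::finite \<Rightarrow> real"
  assumes "open U" "Ck_on k U f" "Ck_on k U g"
  shows "Ck_on k U (\<lambda>x. f x * g x)"
  using assms(2,3)
proof (induction k arbitrary: f g)
  case (Suc k)
  have "Ck_on k U (partial_deriv i (\<lambda>x. f x * g x))" for i
  proof (subst Ck_on_cong[OF assms(1), where g = "\<lambda>x. f x * partial_deriv i g x + partial_deriv i f x * g x"])
    show "Ck_on k U (\<lambda>x. f x * partial_deriv i g x + partial_deriv i f x * g x)"
      using Suc.prems Ck_on_SucD[OF Suc.prems(1)] Ck_on_SucD[OF Suc.prems(2)]
      by (intro Ck_on_add[OF assms(1)] Suc.IH) simp_all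
  qed (use Suc.prems in \<open>auto intro!: partial_deriv_mult\<close>)
  then show ?case using Suc.prems by auto
qed (auto intro: continuous_intros)

lemma Ck_on_sum:
  assumes "open U" "finite I" "\<And>i. i \<in> I \<Longrightarrow> Ck_on k U (f i)"
  shows "Ck_on k U (\<lambda>x. \<Sum>i\<in>I. f i x)"
  using assms(2,3) by (induction I) (auto intro!: Ck_on_add Ck_on_const assms(1))

lemma Ck_on_power:
  fixes f :: "real ^ 'n::finite \<Rightarrow> real"
  assumes "open U" "Ck_on k U f"
  shows "Ck_on k U (\<lambda>x. f x ^ j)"
  by (induction j) (auto intro!: Ck_on_mult Ck_on_const assms)

lemma Ck_on_minus:
  fixes f g :: "real ^ 'n::finite \<Rightarrow> real"
  assumes "open U" "Ck_on k U f" "Ck_on k U g"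
  shows "Ck_on k U (\<lambda>x. f x - g x)"
  using Ck_on_add[OF assms(1,2) Ck_on_mult[OF assms(1) Ck_on_const[of _ _ "-1"] assms(3)]] by simp

text \<open>The class \<open>P\<close> of outer functions is closed under differentiation on \<open>I\<close>, which is what makes the
induction on \<open>k\<close> go through; powers, exponentials and \<open>p(1/t) e\<^sup>-\<^sup>1\<^sup>/\<^sup>t\<close> all fit this pattern.\<close>
lemma Ck_on_compose:
  fixes f :: "real ^ 'n::finite \<Rightarrow> real"
  assumes "open U"
    and P: "\<And>g. P g \<Longrightarrow> \<exists>g'. P g' \<and> (\<forall>t\<in>I. (g has_real_derivative g' t) (at t))"
    and "P g" "Ck_on k U f" "f ` U \<subseteq> I"
  shows "Ck_on k U (\<lambda>x. g (f x))"
  using assms(3-5)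
proof (induction k arbitrary: g)
  case 0
  obtain g' where "\<forall>t\<in>I. (g has_real_derivative g' t) (at t)" using P 0 by blast
  then have "continuous_on I g"
    by (meson DERIV_continuous continuous_at_imp_continuous_on)
  then show ?case using 0 continuous_on_compose2 by auto
next
  case (Suc k)
  obtain g' where g': "P g'" "\<And>t. t \<in> I \<Longrightarrow> (g has_real_derivative g' t) (at t)"
    using P[OF Suc.prems(1)] by blast
  have fd: "f differentiable (at x)" "(g has_real_derivative g' (f x)) (at (f x))" if "x \<in> U" for x
    using that Suc.prems g' by auto
  have "Ck_on k U (partial_deriv i (\<lambda>x. g (f x)))" for i
  proof (subst Ck_on_cong[OF assms(1), where g = "\<lambda>x. g' (f x) * partial_deriv i f x"])
    show "Ck_on k U (\<lambda>x. g' (f x) * partial_deriv i f x)"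
      using Suc.prems(2) by (intro Ck_on_mult[OF assms(1)] Suc.IH[OF g'(1) Ck_on_SucD[OF Suc.prems(2)] Suc.prems(3)]) simp
  qed (rule partial_deriv_compose[OF fd])
  moreover have "(\<lambda>x. g (f x)) differentiable (at x)" if "x \<in> U" for x
    using has_derivative_compose_real[OF fd[OF that]] unfolding differentiable_def by blast
  ultimately show ?case by simp
qed

lemma Ck_on_exp:
  fixes f :: "real ^ 'n::finite \<Rightarrow> real"
  assumes "open U" "Ck_on k U f"
  shows "Ck_on k U (\<lambda>x. exp (f x))"
  by (rule Ck_on_compose[where P = "\<lambda>g. g = exp" and I = UNIV])
     (use assms in \<open>auto intro: DERIV_exp\<close>)

lemma Ck_on_powr:
  fixes f :: "real ^ 'n::finite \<Rightarrow> real"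
  assumes "open U" "Ck_on k U f" "\<And>x. x \<in> U \<Longrightarrow> f x > 0"
  shows "Ck_on k U (\<lambda>x. f x powr a)"
proof (rule Ck_on_compose[where P = "\<lambda>g. \<exists>c a. g = (\<lambda>t. c * t powr a)" and I = "{0<..}"
      and g = "\<lambda>t. t powr a"])
  fix g :: "real \<Rightarrow> real" assume "\<exists>c a. g = (\<lambda>t. c * t powr a)"
  then obtain c a where g: "g = (\<lambda>t. c * t powr a)" by blast
  have "(g has_real_derivative (c * a) * t powr (a - 1)) (at t)" if "t > 0" for t
    unfolding g using that by (auto intro!: derivative_eq_intros)
  then show "\<exists>g'. (\<exists>c a. g' = (\<lambda>t. c * t powr a)) \<and> (\<forall>t\<in>{0<..}. (g has_real_derivative g' t) (at t))"
    by (intro exI[of _ "\<lambda>t. (c * a) * t powr (a - 1)"]) auto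
next
  show "\<exists>c b. (\<lambda>t::real. t powr a) = (\<lambda>t. c * t powr b)" by (rule exI[of _ 1]) auto
qed (use assms in auto)

lemma Ck_on_inverse:
  fixes f :: "real ^ 'n::finite \<Rightarrow> real"
  assumes "open U" "Ck_on k U f" "\<And>x. x \<in> U \<Longrightarrow> f x > 0"
  shows "Ck_on k U (\<lambda>x. inverse (f x))"
proof (subst Ck_on_cong[OF assms(1), where g = "\<lambda>x. f x powr - 1"])
  show "inverse (f y) = f y powr - 1" if "y \<in> U" for y
    using assms(3)[OF that] by (simp add: powr_minus)
qed (rule Ck_on_powr[OF assms])

lemma Ck_on_sqrt:
  fixes f :: "real ^ 'n::finite \<Rightarrow> real"
  assumes "open U" "Ck_on k U f" "\<And>x. x \<in> U \<Longrightarrow> f x > 0"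
  shows "Ck_on k U (\<lambda>x. sqrt (f x))"
proof (subst Ck_on_cong[OF assms(1), where g = "\<lambda>x. f x powr (1/2)"])
  show "sqrt (f y) = f y powr (1/2)" if "y \<in> U" for y
    using assms(3)[OF that] by (simp add: powr_half_sqrt)
qed (rule Ck_on_powr[OF assms])

text \<open>A function whose derivative is \<open>C\<^sup>k\<close> along \<open>f\<close> needs only one differentiation; this covers
  logarithms and antiderivatives that have no closed form.\<close>

lemma Ck_on_antiderivative:
  fixes f :: "real ^ 'n::finite \<Rightarrow> real"
  assumes "open U" "Ck_on k U f" "Ck_on k U (\<lambda>x. g' (f x))"
    and "\<And>x. x \<in> U \<Longrightarrow> (g has_real_derivative g' (f x)) (at (f x))"
  shows "Ck_on k U (\<lambda>x. g (f x))"
proof (cases k)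
  case 0
  have "continuous (at x within U) (\<lambda>x. g (f x))" if "x \<in> U" for x
    by (rule continuous_within_compose3)
      (use assms that 0 in \<open>auto intro: DERIV_isCont simp: continuous_on_eq_continuous_within\<close>)
  then show ?thesis using 0 by (simp add: continuous_on_eq_continuous_within)
next
  case (Suc l)
  have fd: "f differentiable (at x)" if "x \<in> U" for x using assms Suc that by auto
  have "Ck_on l U (partial_deriv i (\<lambda>x. g (f x)))" for i
  proof (subst Ck_on_cong[OF assms(1), where g = "\<lambda>x. g' (f x) * partial_deriv i f x"])
    show "Ck_on l U (\<lambda>x. g' (f x) * partial_deriv i f x)"
      using Ck_on_SucD[OF assms(3)[unfolded Suc]] assms(2)[unfolded Suc] by (intro Ck_on_mult[OF assms(1)]) simp_all
  qed (rule partial_deriv_compose[OF fd assms(4)])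
  moreover have "(\<lambda>x. g (f x)) differentiable (at x)" if "x \<in> U" for x
    using has_derivative_compose_real[OF fd[OF that] assms(4)[OF that]] unfolding differentiable_def by blast
  ultimately show ?thesis using Suc by simp
qed

lemma Ck_on_Un:
  assumes "open U" "open V" "Ck_on k U f" "Ck_on k V f"
  shows "Ck_on k (U \<union> V) f"
  using assms(3,4)
proof (induction k arbitrary: f)
  case 0
  then show ?case using assms(1,2) continuous_on_open_Un by auto
qed auto

lemma Ck_on_subset: "Ck_on k U f \<Longrightarrow> V \<subseteq> U \<Longrightarrow> Ck_on k V f"
  by (induction k arbitrary: f) (auto intro: continuous_on_subset)

lemma partial_deriv_zero_outside:
  assumes "closed S" "\<And>x. x \<notin> S \<Longrightarrow> f x = 0" "x \<notin> S"
  shows "partial_deriv i f x = 0"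
proof -
  have "partial_deriv i f x = partial_deriv i (\<lambda>_. 0) x"
    by (rule partial_deriv_cong[of "- S"]) (use assms in auto)
  then show ?thesis by (simp add: partial_deriv_eq[OF has_derivative_const])
qed

section \<open>Laplacians of compositions and of radial functions\<close>
lemma laplacian_compose:
  fixes f :: "real ^ 'n::finite \<Rightarrow> real"
  assumes "open U" "x \<in> U" "Ck_on (Suc (Suc 0)) U f"
    and g: "\<And>y. y \<in> U \<Longrightarrow> (g has_real_derivative g' (f y)) (at (f y))"
    and g': "(g' has_real_derivative g'') (at (f x))"
  shows "laplacian (\<lambda>y. g (f y)) x
           = g' (f x) * laplacian f x + g'' * (\<Sum>i\<in>UNIV. (partial_deriv i f x)\<^sup>2)"
proof -
  have fd: "f differentiable (at y)" "partial_deriv i f differentiable (at y)" if "y \<in> U" for y i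
    using assms(3) that by auto
  have "(\<lambda>y. g' (f y)) differentiable (at x)"
    using has_derivative_compose_real[OF fd(1)[OF assms(2)] g'] unfolding differentiable_def by blast
  note d = partial_deriv_mult[OF this fd(2)[OF assms(2)]] partial_deriv_compose[OF fd(1)[OF assms(2)] g']
  have "partial_deriv i (partial_deriv i (\<lambda>y. g (f y))) x
      = partial_deriv i (\<lambda>y. g' (f y) * partial_deriv i f y) x" for i
    by (rule partial_deriv_cong[OF assms(1,2)]) (rule partial_deriv_compose[OF fd(1) g])
  then have "partial_deriv i (partial_deriv i (\<lambda>y. g (f y))) x
      = g' (f x) * partial_deriv i (partial_deriv i f) x + g'' * (partial_deriv i f x)\<^sup>2" for i
    using d[of i] by (simp add: power2_eq_square)
  then show ?thesis
    by (simp add: laplacian_def sum.distrib sum_distrib_left)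
qed

lemma laplacian_add:
  fixes f g :: "real ^ 'n::finite \<Rightarrow> real"
  assumes "open U" "x \<in> U" "Ck_on (Suc (Suc 0)) U f" "Ck_on (Suc (Suc 0)) U g"
  shows "laplacian (\<lambda>y. f y + g y) x = laplacian f x + laplacian g x"
proof -
  have "partial_deriv i (partial_deriv i (\<lambda>y. f y + g y)) x
      = partial_deriv i (\<lambda>y. partial_deriv i f y + partial_deriv i g y) x" for i
    by (rule partial_deriv_cong[OF assms(1,2)], rule partial_deriv_add) (use assms in auto)
  also have "\<dots> i = partial_deriv i (partial_deriv i f) x + partial_deriv i (partial_deriv i g) x" for i
    by (rule partial_deriv_add) (use assms in auto)
  finally show ?thesis by (simp add: laplacian_def sum.distrib)
qed

lemma laplacian_cong:
  assumes "open U" "x \<in> U" "\<And>y. y \<in> U \<Longrightarrow> f y = g y"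
  shows "laplacian f x = laplacian g x"
proof -
  have "partial_deriv i (partial_deriv i f) x = partial_deriv i (partial_deriv i g) x" for i
    by (rule partial_deriv_cong[OF assms(1,2)]) (rule partial_deriv_cong[OF assms(1) _ assms(3)])
  then show ?thesis by (simp add: laplacian_def)
qed

lemma laplacian_cmult:
  fixes f :: "real ^ 'n::finite \<Rightarrow> real"
  assumes "open U" "x \<in> U" "Ck_on (Suc (Suc 0)) U f"
  shows "laplacian (\<lambda>y. c * f y) x = c * laplacian f x"
  using laplacian_compose[OF assms, where g = "\<lambda>t. c * t" and g' = "\<lambda>_. c" and g'' = 0]
  by (auto intro!: derivative_eq_intros)

lemma laplacian_const: "laplacian (\<lambda>y. c) (x :: real ^ 'n::finite) = 0"
proof -
  have "partial_deriv i (\<lambda>y :: real ^ 'n. k :: real) = (\<lambda>y. 0)" for i k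
    by (rule ext, subst partial_deriv_eq[OF has_derivative_const]) simp
  then show ?thesis by (simp add: laplacian_def)
qed

text \<open>The shift \<open>a\<close> serves two purposes: \<open>a = s\<^sup>2\<close> smooths a radial profile at its centre, and \<open>a = 0\<close>
gives the plain squared distance for the function with a pole at \<open>x0\<close>.\<close>
definition sqdist :: "real ^ 'n::finite \<Rightarrow> real \<Rightarrow> real ^ 'n \<Rightarrow> real" where
  "sqdist y a x = (norm (x - y))\<^sup>2 + a"

lemma norm_sq_eq_sum: "(norm (x :: real ^ 'n::finite))\<^sup>2 = (\<Sum>i\<in>UNIV. (x $ i)\<^sup>2)"
  unfolding power2_norm_eq_inner inner_vec_def by (simp add: power2_eq_square)

lemma sqdist_altdef: "sqdist y a = (\<lambda>x. (\<Sum>i\<in>UNIV. (x $ i - y $ i)\<^sup>2) + a)"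
  by (rule ext) (simp add: sqdist_def norm_sq_eq_sum)

lemma Ck_on_sqdist: "open U \<Longrightarrow> Ck_on k U (sqdist y a)"
  unfolding sqdist_altdef
  by (intro Ck_on_add Ck_on_sum Ck_on_power Ck_on_minus Ck_on_component Ck_on_const) auto

lemma has_derivative_sqdist: "(sqdist y a has_derivative (\<lambda>h. 2 * ((x - y) \<bullet> h))) (at x)"
  unfolding sqdist_def[abs_def] power2_norm_eq_inner
  by (auto intro!: derivative_eq_intros simp: inner_commute)

lemma partial_deriv_sqdist: "partial_deriv i (sqdist y a) = (\<lambda>x. 2 * (x $ i - y $ i))"
  by (rule ext, subst partial_deriv_eq[OF has_derivative_sqdist]) (simp add: inner_axis)

lemma laplacian_sqdist:
  "laplacian (sqdist y a) (x :: real ^ 'n::finite) = 2 * real CARD('n)"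
proof -
  have d: "((\<lambda>x :: real^'n. 2 * (x $ i - y $ i)) has_derivative (\<lambda>h. 2 * h $ i)) (at x)" for i
    by (auto intro!: derivative_eq_intros bounded_linear_imp_has_derivative)
  show ?thesis
    unfolding laplacian_def partial_deriv_sqdist
    by (simp add: partial_deriv_eq[OF d] del: right_diff_distrib_numeral)
qed

lemma sum_partial_deriv_sqdist:
  "(\<Sum>i\<in>UNIV. (partial_deriv i (sqdist y a) x)\<^sup>2) = 4 * (norm (x - y))\<^sup>2"
  by (simp add: partial_deriv_sqdist power_mult_distrib sum_distrib_left norm_sq_eq_sum
      del: right_diff_distrib_numeral)

lemma laplacian_radial:
  fixes x :: "real ^ 'n::finite" and g g' :: "real \<Rightarrow> real"
  assumes "open U" "x \<in> U"
    and "\<And>z. z \<in> U \<Longrightarrow> (g has_real_derivative g' (sqdist y a z)) (at (sqdist y a z))"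
    and "(g' has_real_derivative g'') (at (sqdist y a x))"
  shows "laplacian (\<lambda>z. g (sqdist y a z)) x
           = 2 * real CARD('n) * g' (sqdist y a x) + 4 * (norm (x - y))\<^sup>2 * g''"
  using laplacian_compose[OF assms(1,2) Ck_on_sqdist[OF assms(1)] assms(3,4)]
  by (simp add: laplacian_sqdist sum_partial_deriv_sqdist)

section \<open>A smooth convex substitute for the positive part\<close>

text \<open>The class of functions \<open>p(1/t) e\<^sup>-\<^sup>1\<^sup>/\<^sup>t\<close>, \<open>p\<close> a polynomial, is closed under differentiation, also at
\<open>t = 0\<close>, where the exponential beats every power.\<close>

definition flat :: "real poly \<Rightarrow> real \<Rightarrow> real" where
  "flat p t = (if t > 0 then poly p (inverse t) * exp (- inverse t) else 0)"

lemma poly_times_exp_minus_tendsto_0: "((\<lambda>z. poly p z * exp (- z :: real)) \<longlongrightarrow> 0) at_top"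
proof -
  have "((\<lambda>z. \<Sum>i\<le>degree p. coeff p i * (z ^ i / exp z)) \<longlongrightarrow> (\<Sum>i\<le>degree p. coeff p i * 0)) at_top"
    by (intro tendsto_sum tendsto_mult tendsto_const tendsto_power_div_exp_0)
  then show ?thesis
    by (simp add: poly_altdef exp_minus sum_distrib_right divide_inverse mult.assoc)
qed

lemma flat_has_derivative:
  "(flat p has_real_derivative flat ([:0, 0, 1:] * (p - pderiv p)) t) (at t)"
proof (cases t "0 :: real" rule: linorder_cases)
  case less
  show ?thesis
    by (rule has_field_derivative_transform_within_open[of "\<lambda>_. 0" _ _ "{..<0}"])
       (use less in \<open>auto simp: flat_def\<close>)
next
  case greater
  have "((\<lambda>t. poly p (inverse t) * exp (- inverse t)) has_real_derivative
          flat ([:0, 0, 1:] * (p - pderiv p)) t) (at t)"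
    using greater
    by (auto intro!: derivative_eq_intros DERIV_chain'[OF _ poly_DERIV]
        simp: flat_def algebra_simps power2_eq_square divide_simps)
  then show ?thesis
    by (rule has_field_derivative_transform_within_open[where S = "{0<..}"])
       (use greater in \<open>auto simp: flat_def\<close>)
next
  case equal
  have "((\<lambda>h. flat p h / h) \<longlongrightarrow> 0) (at 0)"
  proof (rule filterlim_split_at)
    show "((\<lambda>h. flat p h / h) \<longlongrightarrow> 0) (at_left 0)"
      by (rule tendsto_eventually, rule eventually_at_leftI[of "-1"]) (auto simp: flat_def)
    have "((\<lambda>h. poly (pCons 0 p) (inverse h) * exp (- inverse h)) \<longlongrightarrow> 0) (at_right (0::real))"
      by (rule filterlim_compose[OF poly_times_exp_minus_tendsto_0 filterlim_inverse_at_top_right])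
    then show "((\<lambda>h. flat p h / h) \<longlongrightarrow> 0) (at_right 0)"
      by (rule Lim_transform_eventually)
        (auto simp: flat_def eventually_at_right_field divide_simps intro!: exI[of _ 1])
  qed
  then show ?thesis using equal by (simp add: has_field_derivative_iff flat_def)
qed

lemma Ck_on_flat:
  fixes f :: "real ^ 'n::finite \<Rightarrow> real"
  assumes "open U" "Ck_on k U f"
  shows "Ck_on k U (\<lambda>x. flat p (f x))"
  by (rule Ck_on_compose[where P = "\<lambda>g. \<exists>p. g = flat p" and I = UNIV])
     (use assms flat_has_derivative in auto)

text \<open>The convex function \<open>t e\<^sup>-\<^sup>1\<^sup>/\<^sup>t\<close> for \<open>t > 0\<close>, asymptotic to \<open>t - 1\<close>: unlike a power of the positive
part it leaves the strength of the singularity of \<open>w\<close> at \<open>y\<close> unchanged.\<close>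

definition bend :: "real \<Rightarrow> real" where "bend t = t * flat 1 t"

lemma bend_has_derivative: "(bend has_real_derivative flat [:1, 1:] t) (at t)"
proof -
  have "(bend has_real_derivative (1 * flat 1 t + t * flat ([:0, 0, 1:] * (1 - pderiv 1)) t)) (at t)"
    unfolding bend_def[abs_def] by (auto intro!: derivative_eq_intros flat_has_derivative)
  also have "1 * flat 1 t + t * flat ([:0, 0, 1:] * (1 - pderiv 1)) t = flat [:1, 1:] t"
    by (simp add: flat_def pderiv_1 algebra_simps)
  finally show ?thesis .
qed

lemma bend_second_derivative: "(flat [:1, 1:] has_real_derivative flat [:0, 0, 0, 1:] t) (at t)"
  using flat_has_derivative[of "[:1, 1:]" t] by (simp add: pderiv_pCons)

lemma Ck_on_bend:
  fixes f :: "real ^ 'n::finite \<Rightarrow> real"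
  assumes "open U" "Ck_on k U f"
  shows "Ck_on k U (\<lambda>x. bend (f x))"
  unfolding bend_def by (intro Ck_on_mult Ck_on_flat assms)

lemma bend_nonneg: "bend t \<ge> 0"
  by (auto simp: bend_def flat_def)

lemma bend_eq_0: "t \<le> 0 \<Longrightarrow> bend t = 0"
  by (auto simp: bend_def flat_def)

lemma bend_le: "bend t \<le> flat [:1, 1:] t * t"
  by (auto simp: bend_def flat_def algebra_simps)

lemma bend_slope_nonneg: "flat [:1, 1:] t \<ge> 0"
  by (auto simp: flat_def)

lemma bend_slope_le_1: "flat [:1, 1:] t \<le> 1"
proof -
  have "(1 + inverse t) * exp (- inverse t) \<le> exp (inverse t) * exp (- inverse t)"
    by (intro mult_right_mono) (use exp_ge_add_one_self[of "inverse t"] in auto)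
  then show ?thesis by (simp add: flat_def flip: exp_add)
qed

lemma bend_convex: "flat [:0, 0, 0, 1:] t \<ge> 0"
  by (auto simp: flat_def)

lemma bend_convex_lower:
  assumes "0 < a" "a \<le> t" "t \<le> b"
  shows "exp (- inverse a) / b ^ 3 \<le> flat [:0, 0, 0, 1:] t"
proof -
  have "exp (- inverse a) / b ^ 3 \<le> exp (- inverse t) / t ^ 3"
    using assms by (intro frac_le) (auto intro!: power_mono le_imp_inverse_le)
  also have "\<dots> = flat [:0, 0, 0, 1:] t"
    using assms by (simp add: flat_def power3_eq_cube field_simps)
  finally show ?thesis .
qed

section \<open>Radial profiles\<close>

text \<open>Minus the derivative of the profile \<open>\<Psi>\<close> with respect to \<open>\<tau> = \<bar>x - y\<bar>\<^sup>2 + s\<^sup>2\<close>. For \<open>L = e = 0\<close> this is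
\<open>\<tau>\<close> to the power \<open>-n/2\<close>, so that \<open>\<Psi>\<close> is a multiple of the fundamental solution smoothed at scale
\<open>s\<close>. The factor \<open>e\<^sup>-\<^sup>L\<^sup>\<sigma>\<close>, \<open>\<sigma> = \<surd>\<tau>\<close>, absorbs the drift and the potential. The smoothing
leaves a tail of positive mass of relative size \<open>s\<^sup>2/\<tau>\<close> outside \<open>B\<^sub>s(y)\<close>; with \<open>e\<close> a multiple of \<open>s\<close>,
the factor \<open>e\<^sup>e\<^sup>/\<^sup>\<sigma>\<close> contributes a negative term of relative size \<open>s/\<sigma>\<close>, which cancels it, while
the factor itself stays bounded because \<open>\<sigma> \<ge> s\<close>.\<close>
definition radial_slope :: "nat \<Rightarrow> real \<Rightarrow> real \<Rightarrow> real \<Rightarrow> real" where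
  "radial_slope n L e \<tau> = exp (- L * sqrt \<tau> + e / sqrt \<tau>) / sqrt \<tau> ^ n"

definition radial_slope_deriv :: "nat \<Rightarrow> real \<Rightarrow> real \<Rightarrow> real \<Rightarrow> real" where
  "radial_slope_deriv n L e \<tau> =
     - radial_slope n L e \<tau> * (n / (2 * \<tau>) + L / (2 * sqrt \<tau>) + e / (2 * \<tau> * sqrt \<tau>))"

lemma radial_slope_pos: "\<tau> > 0 \<Longrightarrow> radial_slope n L e \<tau> > 0"
  by (simp add: radial_slope_def)

lemma radial_slope_has_derivative:
  assumes "\<tau> > 0"
  shows "(radial_slope n L e has_real_derivative radial_slope_deriv n L e \<tau>) (at \<tau>)"
proof -
  define \<sigma> where "\<sigma> = sqrt \<tau>"
  have \<sigma>: "\<sigma> > 0" "\<tau> = \<sigma> * \<sigma>" using assms by (auto simp: \<sigma>_def)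
  have [simp]: "sqrt (\<sigma> * \<sigma>) = \<sigma>" using \<sigma> by simp
  have deriv: "((\<lambda>\<sigma>. exp (- L * \<sigma> + e / \<sigma>) * inverse (\<sigma> ^ n)) has_real_derivative
      exp (- L * \<sigma> + e / \<sigma>) * (- L - e / (\<sigma> * \<sigma>)) * inverse (\<sigma> ^ n)
      + exp (- L * \<sigma> + e / \<sigma>) * (- (n * \<sigma> ^ (n - 1)) / (\<sigma> ^ n * \<sigma> ^ n))) (at (sqrt \<tau>))"
    using \<sigma>(1) unfolding \<sigma>_def[symmetric]
    by (auto intro!: derivative_eq_intros simp: power2_eq_square field_simps)
  have radial_slope_eq: "radial_slope n L e = (\<lambda>\<tau>. exp (- L * sqrt \<tau> + e / sqrt \<tau>) * inverse (sqrt \<tau> ^ n))"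
    by (rule ext) (simp only: radial_slope_def divide_inverse)
  from DERIV_chain2[OF deriv DERIV_real_sqrt[OF assms]]
  have "(radial_slope n L e has_real_derivative
      (exp (- L * \<sigma> + e / \<sigma>) * (- L - e / (\<sigma> * \<sigma>)) * inverse (\<sigma> ^ n)
      + exp (- L * \<sigma> + e / \<sigma>) * (- (n * \<sigma> ^ (n - 1)) / (\<sigma> ^ n * \<sigma> ^ n))) * (inverse \<sigma> / 2)) (at \<tau>)"
    unfolding radial_slope_eq \<sigma>_def[symmetric] .
  also have "(exp (- L * \<sigma> + e / \<sigma>) * (- L - e / (\<sigma> * \<sigma>)) * inverse (\<sigma> ^ n)
      + exp (- L * \<sigma> + e / \<sigma>) * (- (n * \<sigma> ^ (n - 1)) / (\<sigma> ^ n * \<sigma> ^ n))) * (inverse \<sigma> / 2)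
      = radial_slope_deriv n L e \<tau>"
  proof -
    have n: "n * \<sigma> ^ (n - 1) = n * \<sigma> ^ n / \<sigma>" using \<sigma>(1) by (cases n) auto
    have rearrange: "(E * (- L - e / (\<sigma> * \<sigma>)) * inverse P + E * (- (n * P / \<sigma>) / (P * P))) * (inverse \<sigma> / 2)
        = - (E / P) * (n / (2 * (\<sigma> * \<sigma>)) + L / (2 * \<sigma>) + e / (2 * (\<sigma> * \<sigma>) * \<sigma>))"
      if "P > 0" for E P :: real
      using \<sigma>(1) that by (simp add: divide_simps) (simp add: algebra_simps)
    show ?thesis
      unfolding n radial_slope_deriv_def radial_slope_def \<sigma>_def[symmetric] using \<sigma>(1)
      by (subst rearrange) (simp_all add: \<sigma>(2)[symmetric])
  qed
  finally show ?thesis .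
qed

lemma radial_slope_antimono:
  assumes "0 < \<tau>" "\<tau> \<le> \<tau>'" "L \<ge> 0" "e \<ge> 0"
  shows "radial_slope n L e \<tau>' \<le> radial_slope n L e \<tau>"
proof -
  have s: "0 < sqrt \<tau>" "sqrt \<tau> \<le> sqrt \<tau>'" using assms by auto
  have "L * sqrt \<tau> \<le> L * sqrt \<tau>'" "e / sqrt \<tau>' \<le> e / sqrt \<tau>"
    using s assms by (auto intro!: mult_left_mono divide_left_mono)
  then show ?thesis
    unfolding radial_slope_def using s by (intro frac_le power_mono) auto
qed

lemma radial_slope_lower:
  assumes "0 < \<tau>" "\<tau> \<le> 1" "\<tau> \<le> \<rho>\<^sup>2" "\<rho> > 0" "L \<ge> 0" "e \<ge> 0"
  shows "exp (- L) / \<rho> ^ n \<le> radial_slope n L e \<tau>"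
proof -
  have s: "0 < sqrt \<tau>" "sqrt \<tau> \<le> 1" using assms by auto
  have "sqrt \<tau> \<le> \<rho>" using assms real_le_lsqrt by simp
  moreover have "L * sqrt \<tau> \<le> L" "e / sqrt \<tau> \<ge> 0"
    using s assms by (auto simp: mult_left_le)
  then have "- L \<le> - L * sqrt \<tau> + e / sqrt \<tau>" by linarith
  ultimately show ?thesis
    unfolding radial_slope_def using s assms by (intro frac_le power_mono) auto
qed

lemma radial_slope_upper:
  assumes "s\<^sup>2 \<le> \<tau>" "s > 0" "\<rho>\<^sup>2 \<le> \<tau>" "\<rho> > 0" "L \<ge> 0" "a \<ge> 0"
  shows "radial_slope n L (a * s) \<tau> \<le> exp a / \<rho> ^ n"
proof -
  have s: "s \<le> sqrt \<tau>" "\<rho> \<le> sqrt \<tau>" "sqrt \<tau> > 0"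
    using assms by (auto intro!: real_le_rsqrt intro: less_le_trans[OF zero_less_power])
  have "a * s / sqrt \<tau> \<le> a" using s assms mult_left_mono[OF s(1), of a] by (simp add: pos_divide_le_eq)
  moreover have "L * sqrt \<tau> \<ge> 0" using s assms by auto
  ultimately have "- L * sqrt \<tau> + a * s / sqrt \<tau> \<le> a" by linarith
  then show ?thesis
    unfolding radial_slope_def using s assms by (intro frac_le power_mono) auto
qed

text \<open>Defining \<open>\<Psi>\<close> through its derivative treats \<open>n = 2\<close>, where \<open>\<Psi>\<close> is logarithmic, together with
\<open>n \<ge> 3\<close>.\<close>
lemma radial_slope_antiderivative:
  obtains Q where "\<And>\<tau>. \<tau> > 0 \<Longrightarrow> (Q has_real_derivative - radial_slope n L e \<tau>) (at \<tau>)"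
proof -
  have "isCont (\<lambda>\<tau>. - radial_slope n L e \<tau>) \<tau>" if "0 < ereal \<tau>" for \<tau>
    using that by (auto intro!: isCont_minus DERIV_isCont[OF radial_slope_has_derivative])
  from einterval_antiderivative[of 0 \<infinity>, OF _ this] that show ?thesis
    by (auto simp: has_real_derivative_iff_has_vector_derivative)
qed

lemma antiderivative_bounds:
  assumes Q: "\<And>\<tau>. \<tau> > 0 \<Longrightarrow> (Q has_real_derivative - radial_slope n L e \<tau>) (at \<tau>)"
    and "0 < \<tau>" "\<tau> \<le> T" "L \<ge> 0" "e \<ge> 0"
  shows "(T - \<tau>) * radial_slope n L e T \<le> Q \<tau> - Q T" "Q \<tau> - Q T \<le> (T - \<tau>) * radial_slope n L e \<tau>"
proof -
  have "(T - \<tau>) * radial_slope n L e T \<le> Q \<tau> - Q T \<and> Q \<tau> - Q T \<le> (T - \<tau>) * radial_slope n L e \<tau>"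
  proof (cases "\<tau> = T")
    case False
    then have "\<tau> < T" using assms by simp
    from MVT2[OF this, of Q "\<lambda>\<tau>. - radial_slope n L e \<tau>"] Q assms(2)
    obtain z where z: "\<tau> < z" "z < T" "Q T - Q \<tau> = (T - \<tau>) * - radial_slope n L e z" by auto
    have "radial_slope n L e z \<le> radial_slope n L e \<tau>" "radial_slope n L e T \<le> radial_slope n L e z"
      using z(1,2) assms by (auto intro!: radial_slope_antimono)
    then have "(T - \<tau>) * radial_slope n L e z \<le> (T - \<tau>) * radial_slope n L e \<tau>"
      "(T - \<tau>) * radial_slope n L e T \<le> (T - \<tau>) * radial_slope n L e z"
      using assms(3) by (auto intro!: mult_left_mono)
    then show ?thesis using z(3) by simp
  qed simp
  then show "(T - \<tau>) * radial_slope n L e T \<le> Q \<tau> - Q T" "Q \<tau> - Q T \<le> (T - \<tau>) * radial_slope n L e \<tau>" by auto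
qed

text \<open>The potential term needs \<open>\<Psi>\<close> itself to be controlled by its slope. The function
\<open>2 \<surd>\<tau> q(\<tau>)\<close>, with \<open>q\<close> the slope, decays at least like \<open>\<tau>\<close> to the power \<open>(1-n)/2\<close>; for \<open>n \<ge> 2\<close> and \<open>\<tau> \<le> 1\<close>
it therefore decreases at least as fast as \<open>\<Psi>\<close>, and at \<open>T\<close> it is still nonnegative.\<close>
lemma antiderivative_le:
  assumes Q: "\<And>\<tau>. \<tau> > 0 \<Longrightarrow> (Q has_real_derivative - radial_slope n L e \<tau>) (at \<tau>)"
    and "0 < \<tau>" "\<tau> \<le> T" "T \<le> 1" "n \<ge> 2" "L \<ge> 0" "e \<ge> 0"
  shows "Q \<tau> - Q T \<le> 2 * sqrt \<tau> * radial_slope n L e \<tau>"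
proof -
  define N where "N t = 2 * sqrt t * radial_slope n L e t - Q t" for t
  have "N T \<le> N \<tau>"
  proof (rule DERIV_nonpos_imp_nonincreasing[OF assms(3)])
    fix t assume t: "\<tau> \<le> t" "t \<le> T"
    then have t0: "t > 0" "t \<le> 1" using assms by auto
    define \<sigma> where "\<sigma> = sqrt t"
    have \<sigma>: "\<sigma> > 0" "t = \<sigma> * \<sigma>" "\<sigma> \<le> 1" using t0 by (auto simp: \<sigma>_def)
    define k where "k = radial_slope n L e t"
    have k: "k > 0" using radial_slope_pos t0 by (simp add: k_def)
    have "(N has_real_derivative 2 * (inverse \<sigma> / 2) * k + 2 * \<sigma> * radial_slope_deriv n L e t + k) (at t)"
      unfolding N_def \<sigma>_def k_def using t0
      by (auto intro!: derivative_eq_intros radial_slope_has_derivative Q)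
    moreover have "2 * (inverse \<sigma> / 2) * k + 2 * \<sigma> * radial_slope_deriv n L e t + k
        = k * ((1 - real n) / \<sigma> + 1) - k * (L + e / (\<sigma> * \<sigma>))"
    proof -
      have "radial_slope_deriv n L e t = - k * (n / (2 * (\<sigma> * \<sigma>)) + L / (2 * \<sigma>) + e / (2 * (\<sigma> * \<sigma>) * \<sigma>))"
        by (simp add: radial_slope_deriv_def k_def[symmetric] \<sigma>_def[symmetric] \<sigma>(2)[symmetric])
      then show ?thesis using \<sigma>(1) by (simp add: divide_simps) (simp add: algebra_simps)
    qed
    moreover have "k * ((1 - real n) / \<sigma> + 1) \<le> 0"
    proof -
      have "(real n - 1) / \<sigma> \<ge> 1" using \<sigma> assms by (simp add: divide_simps)
      then have "(1 - real n) / \<sigma> + 1 \<le> 0" using \<sigma> by (simp add: divide_simps)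
      then show ?thesis using k by (simp add: mult_le_0_iff)
    qed
    moreover have "k * (L + e / (\<sigma> * \<sigma>)) \<ge> 0" using k assms by auto
    ultimately show "\<exists>y. (N has_real_derivative y) (at t) \<and> y \<le> 0"
      by (intro exI[of _ "2 * (inverse \<sigma> / 2) * k + 2 * \<sigma> * radial_slope_deriv n L e t + k"]) auto
  qed
  moreover have "2 * sqrt T * radial_slope n L e T \<ge> 0"
    using radial_slope_pos[of T n L e] assms by auto
  ultimately show ?thesis by (simp add: N_def)
qed

text \<open>The left-hand side bounds \<open>- \<Delta>\<Psi> + M \<bar>\<nabla>\<Psi>\<bar> + K (\<Psi> - \<Psi>(T))\<close> at distance \<open>\<surd>t\<close> from \<open>y\<close>. When \<open>t \<ge> s\<^sup>2\<close>,
so that \<open>2 t \<ge> \<tau>\<close>, the derivative of \<open>e\<^sup>-\<^sup>L\<^sup>\<sigma>\<close> with \<open>L = 2 M + 2 K\<close> dominates drift and potential, and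
that of \<open>e\<^sup>2\<^sup>n\<^sup>s\<^sup>/\<^sup>\<sigma>\<close> dominates the smoothing tail. Inside \<open>B\<^sub>s(y)\<close> only the crude bound
survives.\<close>
lemma radial_slope_subsolution:
  fixes n :: nat and s t M K q q' :: real
  assumes "0 < s" "t \<ge> 0" "M \<ge> 0" "K \<ge> 0" "t + s\<^sup>2 \<le> 1"
  defines "q \<equiv> radial_slope n (2 * M + 2 * K) (2 * real n * s) (t + s\<^sup>2)"
    and "q' \<equiv> radial_slope_deriv n (2 * M + 2 * K) (2 * real n * s) (t + s\<^sup>2)"
  shows "2 * real n * q + 4 * t * q' + 2 * M * sqrt t * q + K * (2 * sqrt (t + s\<^sup>2) * q)
           \<le> (2 * real n + 2 * M + 2 * K) * q"
    and "t \<ge> s\<^sup>2 \<Longrightarrow> 2 * real n * q + 4 * t * q' + 2 * M * sqrt t * q + K * (2 * sqrt (t + s\<^sup>2) * q) \<le> 0"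
proof -
  define \<tau> where "\<tau> = t + s\<^sup>2"
  define \<sigma> where "\<sigma> = sqrt \<tau>"
  have \<tau>: "\<tau> > 0" "s\<^sup>2 \<le> \<tau>" "t \<le> \<tau>" "\<tau> \<le> 1" using assms by (auto simp: \<tau>_def add_nonneg_pos)
  have \<sigma>: "\<sigma> > 0" "\<tau> = \<sigma> * \<sigma>" "s \<le> \<sigma>" "sqrt t \<le> \<sigma>" "\<sigma> \<le> 1"
    using \<tau> by (auto simp: \<sigma>_def intro!: real_le_rsqrt)
  have q: "q > 0" using \<tau> by (simp add: q_def radial_slope_pos flip: \<tau>_def)
  have q': "q' = - q * (n / (2 * \<tau>) + (2 * M + 2 * K) / (2 * \<sigma>) + 2 * real n * s / (2 * \<tau> * \<sigma>))"
    by (simp add: q_def q'_def radial_slope_deriv_def \<tau>_def[symmetric] \<sigma>_def[symmetric])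
  let ?E = "2 * real n * q + 4 * t * q' + 2 * M * sqrt t * q + K * (2 * sqrt (t + s\<^sup>2) * q)"
  have E: "?E = q * (2 * real n + 2 * M * sqrt t + 2 * K * \<sigma> - 2 * real n * (t / \<tau>)
      - 2 * t * (2 * M + 2 * K) / \<sigma> - 4 * real n * t * s / (\<tau> * \<sigma>))"
    unfolding q' \<tau>_def[symmetric] \<sigma>_def[symmetric] using \<sigma>(1) \<tau>(1) by (simp add: divide_simps) (simp add: algebra_simps)
  have "sqrt t \<le> 1" using \<sigma> by linarith
  then have "2 * M * sqrt t \<le> 2 * M * 1" "2 * K * \<sigma> \<le> 2 * K * 1"
    using \<sigma>(5) assms(3,4) by (simp_all add: mult_left_le)
  moreover have "2 * real n * (t / \<tau>) \<ge> 0" "2 * t * (2 * M + 2 * K) / \<sigma> \<ge> 0" "4 * real n * t * s / (\<tau> * \<sigma>) \<ge> 0"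
    using \<sigma> \<tau> assms(1-4) by auto
  ultimately have "2 * real n + 2 * M * sqrt t + 2 * K * \<sigma> - 2 * real n * (t / \<tau>)
      - 2 * t * (2 * M + 2 * K) / \<sigma> - 4 * real n * t * s / (\<tau> * \<sigma>) \<le> 2 * real n + 2 * M + 2 * K" by linarith
  then show "?E \<le> (2 * real n + 2 * M + 2 * K) * q"
    unfolding E using q by (simp add: mult.commute mult_left_mono)
  assume t: "t \<ge> s\<^sup>2"
  have t2: "2 * t \<ge> \<sigma> * \<sigma>" using t \<sigma>(2) unfolding \<tau>_def by simp
  have "2 * t * (2 * M + 2 * K) / \<sigma> \<ge> (\<sigma> * \<sigma>) * (2 * M + 2 * K) / \<sigma>"
    using t2 \<sigma> assms by (intro divide_right_mono mult_right_mono) auto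
  then have 1: "2 * t * (2 * M + 2 * K) / \<sigma> \<ge> \<sigma> * (2 * M + 2 * K)" using \<sigma> by simp
  have 2: "2 * M * sqrt t \<le> 2 * M * \<sigma>" using \<sigma> assms by (intro mult_left_mono) auto
  have "4 * real n * t * s / (\<tau> * \<sigma>) \<ge> 2 * real n * (\<sigma> * \<sigma>) * s / (\<tau> * \<sigma>)"
    using t2 \<sigma> \<tau> assms mult_left_mono[OF t2, of "2 * real n * s"]
    by (intro divide_right_mono) (auto simp: mult_ac)
  then have 3: "4 * real n * t * s / (\<tau> * \<sigma>) \<ge> 2 * real n * (s / \<sigma>)" using \<sigma> by simp
  have "(s * s) / (\<sigma> * \<sigma>) \<le> (s * \<sigma>) / (\<sigma> * \<sigma>)"
    using \<sigma> assms by (intro divide_right_mono mult_left_mono) auto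
  then have "1 - t / \<tau> \<le> s / \<sigma>"
    using \<sigma> by (simp add: \<tau>_def divide_simps power2_eq_square)
  then have 4: "2 * real n * (1 - t / \<tau>) \<le> 2 * real n * (s / \<sigma>)" by (intro mult_left_mono) auto
  have "2 * real n + 2 * M * sqrt t + 2 * K * \<sigma> - 2 * real n * (t / \<tau>)
      - 2 * t * (2 * M + 2 * K) / \<sigma> - 4 * real n * t * s / (\<tau> * \<sigma>) \<le> 0"
    using 1 2 3 4 by (simp add: algebra_simps)
  then show "?E \<le> 0" unfolding E using q by (simp add: mult_le_0_iff)
qed

text \<open>A radial supersolution with a logarithmic pole, as a function of the squared distance \<open>t \<le> 1\<close>.
The function \<open>- ln t\<close> is superharmonic for all \<open>n \<ge> 2\<close>. Its drift term is of order \<open>t\<close> to the power \<open>-1/2\<close>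
and is compensated by \<open>- 2 M \<surd>t\<close>; the constant \<open>3 M\<close> makes the potential term large enough to
absorb the bounded remainder.\<close>
definition pole :: "real \<Rightarrow> real \<Rightarrow> real" where
  "pole M t = 3 * M - 2 * M * sqrt t - ln t"

definition pole_deriv :: "real \<Rightarrow> real \<Rightarrow> real" where
  "pole_deriv M t = - M / sqrt t - 1 / t"

definition pole_deriv2 :: "real \<Rightarrow> real \<Rightarrow> real" where
  "pole_deriv2 M t = M / (2 * t * sqrt t) + 1 / t\<^sup>2"

lemma pole_has_derivative: "t > 0 \<Longrightarrow> (pole M has_real_derivative pole_deriv M t) (at t)"
  unfolding pole_def[abs_def] pole_deriv_def
  by (auto intro!: derivative_eq_intros simp: divide_simps)

lemma pole_deriv_has_derivative:
  "t > 0 \<Longrightarrow> (pole_deriv M has_real_derivative pole_deriv2 M t) (at t)"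
  unfolding pole_deriv_def[abs_def] pole_deriv2_def
  by (auto intro!: derivative_eq_intros simp: field_simps power2_eq_square)

lemma pole_lower:
  assumes "0 < t" "t \<le> 1" "M \<ge> 0"
  shows "pole M t \<ge> M - ln t" "pole M t \<ge> M"
proof -
  have "2 * M * sqrt t \<le> 2 * M * 1" using assms by (intro mult_left_mono) auto
  then show "pole M t \<ge> M - ln t" by (simp add: pole_def)
  moreover have "ln t \<le> 0" using assms by (simp add: ln_le_zero_iff)
  ultimately show "pole M t \<ge> M" by simp
qed

lemma pole_supersolution:
  fixes n :: nat and t M K :: real
  assumes "0 < t" "t \<le> 1" "M \<ge> 0" "n \<ge> 2" "K \<ge> 2 * M"
  shows "2 * real n * pole_deriv M t + 4 * t * pole_deriv2 M t
           + 2 * M * sqrt t * \<bar>pole_deriv M t\<bar> - K * pole M t \<le> 0"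
proof -
  define \<sigma> where "\<sigma> = sqrt t"
  have \<sigma>: "\<sigma> > 0" "t = \<sigma> * \<sigma>" using assms by (auto simp: \<sigma>_def)
  have a: "\<bar>pole_deriv M t\<bar> = M / \<sigma> + 1 / (\<sigma> * \<sigma>)"
  proof -
    have "pole_deriv M t = - (M / \<sigma> + 1 / (\<sigma> * \<sigma>))"
      by (simp add: pole_deriv_def flip: \<sigma>_def \<sigma>(2))
    moreover have "M / \<sigma> + 1 / (\<sigma> * \<sigma>) \<ge> 0" using \<sigma>(1) assms(3) by simp
    ultimately show ?thesis by simp
  qed
  have "2 * real n * pole_deriv M t + 4 * t * pole_deriv2 M t + 2 * M * sqrt t * \<bar>pole_deriv M t\<bar>
      = (4 - 2 * real n) / (\<sigma> * \<sigma>) + M * ((4 - 2 * real n) / \<sigma>) + 2 * M * M"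
    unfolding a unfolding pole_deriv_def pole_deriv2_def \<sigma>_def[symmetric] using \<sigma>(1)
    by (simp add: \<sigma>(2) divide_simps power2_eq_square) (simp add: algebra_simps)
  moreover have "(4 - 2 * real n) / (\<sigma> * \<sigma>) \<le> 0" "(4 - 2 * real n) / \<sigma> \<le> 0"
    using \<sigma> assms by (auto intro!: divide_nonpos_pos)
  moreover have "M * ((4 - 2 * real n) / \<sigma>) \<le> 0"
    using mult_nonneg_nonpos[OF assms(3)] calculation(3) by blast
  moreover have "2 * M * M \<le> K * pole M t"
    using pole_lower(2)[OF assms(1-3)] assms by (intro mult_mono) auto
  ultimately show ?thesis by linarith
qed

section \<open>The test function\<close>

text \<open>Up to powers of \<open>s\<close> and \<open>r\<close>, \<open>mass_const\<close> bounds the positive part of the adjoint operator near \<open>y\<close>, and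
\<open>gain_const\<close> bounds \<open>F''(w) \<bar>\<nabla>w\<bar>\<^sup>2\<close> from below in the outer shell: there \<open>w\<close> lies between
\<open>e\<^sup>-\<^sup>L / 64\<close> and \<open>8\<^sup>n e\<^sup>2\<^sup>n\<close>, and \<open>r \<bar>\<nabla>w\<bar> \<ge> e\<^sup>-\<^sup>L / 8\<close>.\<close>
definition mass_const :: "nat \<Rightarrow> real \<Rightarrow> real \<Rightarrow> real" where
  "mass_const n M K = (2 * real n + 2 * M + 2 * K) * exp (2 * real n)"

definition gain_const :: "nat \<Rightarrow> real \<Rightarrow> real" where
  "gain_const n L = exp (- inverse (exp (- L) / 64)) / (8 ^ n * exp (2 * real n)) ^ 3 * (exp (- L) / 8)\<^sup>2"

text \<open>The test function described at the beginning. The bound holds for all coefficient values \<open>\<beta>\<close>, \<open>d\<close>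
at a point because the adjoint operator is \<open>- \<Delta>\<phi> - b \<bullet> \<nabla>\<phi> + (M - div b) \<phi>\<close>, and only \<open>\<bar>b\<bar> \<le> M\<close> and
\<open>M - div b \<le> K\<close> are known.

The profile is cut off at \<open>\<bar>x - y\<bar> = R\<close>, where \<open>R\<close> is chosen so that the ball of radius \<open>R\<close> around \<open>y\<close>
is internally tangent to the sphere of radius \<open>7r/8\<close> around \<open>x0\<close>. Near the point of tangency the
support reaches into the shell \<open>\<bar>x - x0\<bar> \<ge> r/2\<close>, and the gain is collected in a ball whose centre \<open>p\<close>
lies on the ray from \<open>x0\<close> through \<open>y\<close> at distance \<open>3r/4\<close> from \<open>x0\<close>. The factor
\<open>lam = r\<^sup>n / r\<^sup>2\<close> makes \<open>w\<close> of order one there for every \<open>r\<close>.\<close>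
lemma barrier_test_function:
  fixes x0 y :: "real ^ 'n::finite" and M K r s :: real
  assumes n2: "CARD('n) \<ge> 2" and M: "M \<ge> 0" and K: "K \<ge> 2 * M" and r: "0 < r" "r \<le> 1"
    and y: "y \<noteq> x0" "norm (y - x0) < r / 2" and s: "0 < s" "s \<le> r / 8"
  obtains \<phi> p where "test_function (ball x0 r - {x0}) \<phi>" "\<And>x. \<phi> x \<ge> 0"
    "ball p (r / 16) \<subseteq> ball x0 r - ball x0 (r / 2)"
    "\<And>x \<beta> d. x \<in> ball x0 r - {x0} \<Longrightarrow> norm \<beta> \<le> M \<Longrightarrow> d \<le> K \<Longrightarrow>
       - laplacian \<phi> x - (\<Sum>i\<in>UNIV. \<beta> $ i * partial_deriv i \<phi> x) + d * \<phi> x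
         \<le> r ^ CARD('n) / r\<^sup>2 * (mass_const CARD('n) M K / s ^ CARD('n)) * indicator (ball y s) x
           - gain_const CARD('n) (2 * M + 2 * K) / r\<^sup>2 * indicator (ball p (r / 16)) x"
proof -
  define n where "n = CARD('n)"
  define L where "L = 2 * M + 2 * K"
  define R where "R = 7 * r / 8 - norm (y - x0)"
  define T where "T = R\<^sup>2 + s\<^sup>2"
  define lam where "lam = r ^ n / r\<^sup>2"
  define X where "X = 3 * M - ln (r\<^sup>2 / 4)"
  \<comment> \<open>\<open>X\<close> bounds the pole function on the outer shell; \<open>\<delta>\<close> is so small that the pole changes
    neither the size of \<open>w\<close> nor that of its gradient by more than a fraction there.\<close>
  define \<delta> where "\<delta> = (exp (- L) / 64) / (4 + 2 * M + \<bar>X\<bar>)"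
  define U where "U = ball x0 r - {x0}"
  define e where "e = 2 * real n * s"
  define p where "p = x0 + (3 * r / 4 / norm (y - x0)) *\<^sub>R (y - x0)"
  define q where "q = radial_slope n L e"
  define q' where "q' = radial_slope_deriv n L e"
  have U: "open U" unfolding U_def by (auto intro: open_Diff)
  have KL: "K \<ge> 0" "L \<ge> 0" "e \<ge> 0" using M K s by (auto simp: L_def e_def)
  have R: "3 * r / 8 < R" "R < 7 * r / 8" using y by (auto simp: R_def)
  have T: "0 < T" "T \<le> r\<^sup>2" "T \<le> 1"
  proof -
    have "R\<^sup>2 \<le> (7 * r / 8)\<^sup>2" "s\<^sup>2 \<le> (r / 8)\<^sup>2" using R r s by (auto intro!: power_mono)
    then have "T \<le> 49 / 64 * r\<^sup>2 + 1 / 64 * r\<^sup>2" by (simp add: T_def power2_eq_square)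
    then show "T \<le> r\<^sup>2" using zero_le_power2[of r] by linarith
    then show "T \<le> 1" using r power_le_one[of r 2] by simp
    show "0 < T" using s by (simp add: T_def add_nonneg_pos)
  qed
  have lam: "lam > 0" using r by (simp add: lam_def)
  have \<delta>: "\<delta> > 0" "\<delta> * X \<le> exp (- L) / 64" "\<delta> * (4 + 2 * M) \<le> exp (- L) / 64"
  proof -
    define D where "D = 4 + 2 * M + \<bar>X\<bar>"
    define c where "c = exp (- L) / 64"
    have D: "D > 0" "X \<le> D" "4 + 2 * M \<le> D" and c: "c > 0" using M by (auto simp: D_def c_def)
    have \<delta>: "\<delta> = c / D" by (simp add: \<delta>_def c_def D_def)
    have "c * X \<le> c * D" "c * (4 + 2 * M) \<le> c * D" using D c by (simp_all add: mult_left_mono)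
    then have "\<delta> * X \<le> c" "\<delta> * (4 + 2 * M) \<le> c" "\<delta> > 0"
      unfolding \<delta> times_divide_eq_left using D c by (simp_all only: pos_divide_le_eq divide_pos_pos)
    then show "\<delta> > 0" "\<delta> * X \<le> exp (- L) / 64" "\<delta> * (4 + 2 * M) \<le> exp (- L) / 64"
      by (simp_all only: c_def)
  qed
  obtain Q where Q: "\<And>\<tau>. \<tau> > 0 \<Longrightarrow> (Q has_real_derivative - q \<tau>) (at \<tau>)"
    using radial_slope_antiderivative unfolding q_def by blast
  have q_pos: "\<tau> > 0 \<Longrightarrow> q \<tau> > 0" for \<tau> by (simp add: q_def radial_slope_pos)
  have Q_mono: "Q \<tau>' \<le> Q \<tau>" if "0 < \<tau>" "\<tau> \<le> \<tau>'" for \<tau> \<tau>'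
    using antiderivative_bounds(1)[OF Q[unfolded q_def] that KL(2,3)] q_pos[of \<tau>'] that
    by (smt (verit) mult_nonneg_nonneg q_def)
  define \<tau> where "\<tau> = sqdist y (s\<^sup>2)"
  define t where "t = sqdist x0 0"
  have \<tau>: "\<tau> x = (norm (x - y))\<^sup>2 + s\<^sup>2" "\<tau> x > 0" "\<tau> x \<ge> s\<^sup>2" for x
    using s by (auto simp: \<tau>_def sqdist_def add_nonneg_pos)
  have t: "t x = (norm (x - x0))\<^sup>2" "sqrt (t x) = norm (x - x0)" for x
    by (auto simp: t_def sqdist_def)
  have tU: "0 < t x" "t x \<le> 1" if "x \<in> U" for x
  proof -
    have "0 < norm (x - x0)" "norm (x - x0) \<le> 1" using that r by (auto simp: U_def dist_norm norm_minus_commute)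
    then show "0 < t x" "t x \<le> 1" unfolding t(1) by (auto intro: power_le_one)
  qed
  define g where "g = pole_deriv M"
  define w where "w x = (lam * Q (\<tau> x) + (- \<delta>) * pole M (t x)) + (- lam * Q T)" for x
  have w: "w x = lam * (Q (\<tau> x) - Q T) - \<delta> * pole M (t x)" for x by (simp add: w_def algebra_simps)
  \<comment> \<open>the gradient of \<open>w\<close>\<close>
  define v where "v x = (- (2 * lam * q (\<tau> x))) *\<^sub>R (x - y) - (2 * \<delta> * g (t x)) *\<^sub>R (x - x0)" for x
  have C\<tau>: "Ck_on k U \<tau>" and Ct: "Ck_on k U t" for k
    unfolding \<tau>_def t_def by (auto intro: Ck_on_sqdist U)
  have C1: "Ck_on k U (\<lambda>x. Q (\<tau> x))" for k
  proof (rule Ck_on_antiderivative[OF U C\<tau>, where g' = "\<lambda>\<tau>. - q \<tau>"])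
    have "Ck_on k U (\<lambda>x. 0 - exp (- L * sqrt (\<tau> x) + e * inverse (sqrt (\<tau> x))) * inverse (sqrt (\<tau> x)) ^ n)"
      using \<tau>(2) by (intro Ck_on_minus Ck_on_mult Ck_on_exp Ck_on_add Ck_on_power Ck_on_inverse Ck_on_sqrt
          Ck_on_const C\<tau> U) auto
    then show "Ck_on k U (\<lambda>x. - q (\<tau> x))"
      by (simp add: q_def radial_slope_def divide_inverse power_inverse)
  qed (use \<tau>(2) Q in auto)
  have C2: "Ck_on k U (\<lambda>x. pole M (t x))" for k
    unfolding pole_def
  proof (intro Ck_on_minus Ck_on_mult Ck_on_const Ck_on_sqrt U Ct)
    show "Ck_on k U (\<lambda>x. ln (t x))"
      by (rule Ck_on_antiderivative[OF U Ct, where g' = inverse])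
        (use tU in \<open>auto intro!: Ck_on_inverse U Ct DERIV_ln\<close>)
  qed (use tU in auto)
  have Cw: "Ck_on k U w" for k
    unfolding w_def[abs_def] by (intro Ck_on_add Ck_on_mult Ck_on_const C1 C2 U)
  have w_der: "(w has_derivative (\<lambda>h. v x \<bullet> h)) (at x)" if "x \<in> U" for x
  proof -
    have 1: "((\<lambda>x. Q (\<tau> x)) has_derivative (\<lambda>h. (- q (\<tau> x)) * (2 * ((x - y) \<bullet> h)))) (at x)"
      using has_derivative_compose[OF has_derivative_sqdist[of y "s\<^sup>2" x, folded \<tau>_def]
          Q[OF \<tau>(2), unfolded has_field_derivative_def]] .
    have 2: "((\<lambda>x. pole M (t x)) has_derivative (\<lambda>h. g (t x) * (2 * ((x - x0) \<bullet> h)))) (at x)"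
      using has_derivative_compose[OF has_derivative_sqdist[of x0 0 x, folded t_def]
          pole_has_derivative[OF tU(1)[OF that], unfolded has_field_derivative_def]] by (simp add: g_def)
    have "(\<lambda>h. lam * (- q (\<tau> x) * (2 * ((x - y) \<bullet> h))) + - \<delta> * (g (t x) * (2 * ((x - x0) \<bullet> h))) + 0)
        = (\<lambda>h. v x \<bullet> h)"
      by (simp add: v_def fun_eq_iff inner_diff_left algebra_simps)
    with has_derivative_add[OF has_derivative_add[OF has_derivative_mult_right[OF 1, of lam]
          has_derivative_mult_right[OF 2, of "- \<delta>"]] has_derivative_const[of "- lam * Q T"]]
    show ?thesis unfolding w_def[abs_def] by simp
  qed
  have w_pd: "partial_deriv i w x = v x $ i" if "x \<in> U" for x i
    using partial_deriv_eq[OF w_der[OF that]] by (simp add: inner_axis)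
  have w_lap: "laplacian w x = - lam * (2 * real n * q (\<tau> x) + 4 * (norm (x - y))\<^sup>2 * q' (\<tau> x))
      - \<delta> * (2 * real n * g (t x) + 4 * t x * pole_deriv2 M (t x))" if x: "x \<in> U" for x
  proof -
    have 1: "laplacian (\<lambda>x. Q (\<tau> x)) x = 2 * real n * (- q (\<tau> x)) + 4 * (norm (x - y))\<^sup>2 * (- q' (\<tau> x))"
      unfolding \<tau>_def n_def
    proof (rule laplacian_radial[OF U x, where g' = "\<lambda>z. - q z" and g'' = "- q' (sqdist y (s\<^sup>2) x)"])
      show "(Q has_real_derivative - q (sqdist y (s\<^sup>2) z)) (at (sqdist y (s\<^sup>2) z))" for z
        using Q[OF \<tau>(2)[of z]] by (simp add: \<tau>_def)
      show "((\<lambda>z. - q z) has_real_derivative - q' (sqdist y (s\<^sup>2) x)) (at (sqdist y (s\<^sup>2) x))"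
        using DERIV_minus[OF radial_slope_has_derivative[OF \<tau>(2)[of x], of n L e]]
        by (simp add: \<tau>_def q_def q'_def)
    qed
    have 2: "laplacian (\<lambda>x. pole M (t x)) x = 2 * real n * g (t x) + 4 * (norm (x - x0))\<^sup>2 * pole_deriv2 M (t x)"
      unfolding t_def n_def g_def
      by (rule laplacian_radial[OF U x])
        (use tU x in \<open>auto simp: t_def intro: pole_has_derivative pole_deriv_has_derivative\<close>)
    have 3: "laplacian (\<lambda>x. - lam * Q T) x = 0" by (rule laplacian_const)
    have "laplacian w x = lam * laplacian (\<lambda>x. Q (\<tau> x)) x + (- \<delta>) * laplacian (\<lambda>x. pole M (t x)) x"
      unfolding w_def[abs_def] using C1 C2
      by (simp only: laplacian_add[OF U x] laplacian_cmult[OF U x] Ck_on_add[OF U]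
          Ck_on_mult[OF U] Ck_on_const 3 add_0_right)
    then show ?thesis unfolding 1 2 unfolding t(1)[of x] by (simp add: algebra_simps)
  qed
  have far: "w x \<le> 0" if "x \<in> U" "R \<le> norm (x - y)" for x
  proof -
    have "T \<le> \<tau> x" unfolding \<tau>(1) T_def using that R r by (intro add_right_mono power_mono) auto
    then have "Q (\<tau> x) \<le> Q T" using Q_mono T by blast
    then have "lam * (Q (\<tau> x) - Q T) \<le> 0" using lam by (simp add: mult_le_0_iff)
    moreover have "\<delta> * pole M (t x) \<ge> 0"
      using pole_lower(2)[OF tU[OF that(1)] M] M \<delta> by auto
    ultimately show ?thesis by (simp add: w)
  qed
  \<comment> \<open>At distance \<open>\<epsilon>\<close> the pole term \<open>- \<delta> ln t\<close> has reached the maximum of the profile.\<close>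
  define \<epsilon> where "\<epsilon> = sqrt (exp (- (lam * (Q (s\<^sup>2) - Q T)) / \<delta>))"
  have "\<epsilon> > 0" by (simp add: \<epsilon>_def)
  have near: "w x \<le> 0" if "x \<in> U" "norm (x - x0) < \<epsilon>" for x
  proof -
    have "t x < \<epsilon>\<^sup>2" unfolding t(1) using that by (intro power_strict_mono) auto
    then have "t x < exp (- (lam * (Q (s\<^sup>2) - Q T)) / \<delta>)" by (simp add: \<epsilon>_def)
    then have "ln (t x) \<le> - (lam * (Q (s\<^sup>2) - Q T)) / \<delta>"
      using tU[OF that(1)] by (metis ln_exp ln_less_cancel_iff exp_gt_zero less_imp_le)
    from mult_left_mono[OF this, of \<delta>]
    have "\<delta> * ln (t x) \<le> - (lam * (Q (s\<^sup>2) - Q T))" using \<delta>(1) by simp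
    moreover have "lam * (Q (\<tau> x) - Q T) \<le> lam * (Q (s\<^sup>2) - Q T)"
      using Q_mono[of "s\<^sup>2" "\<tau> x"] \<tau>(3) s lam by (intro mult_left_mono) auto
    moreover have "\<delta> * pole M (t x) \<ge> \<delta> * (- ln (t x))"
      using pole_lower(1)[OF tU[OF that(1)] M] M \<delta> by (intro mult_left_mono) auto
    ultimately show ?thesis by (simp add: w)
  qed
  define \<phi> where "\<phi> x = (if x \<in> U then bend (w x) else 0)" for x
  define S where "S = cball y R - ball x0 \<epsilon>"
  have S: "compact S" unfolding S_def by (simp add: compact_diff)
  have SU: "S \<subseteq> U"
  proof
    fix x assume "x \<in> S"
    then have "norm (x - y) \<le> R" "x \<noteq> x0"
      using \<open>\<epsilon> > 0\<close> by (auto simp: S_def dist_norm norm_minus_commute)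
    moreover have "norm (x - x0) \<le> norm (x - y) + norm (y - x0)"
      using norm_triangle_ineq[of "x - y" "y - x0"] by simp
    ultimately have "norm (x - x0) < r" using r by (simp add: R_def)
    with \<open>x \<noteq> x0\<close> show "x \<in> U" by (simp add: U_def dist_norm norm_minus_commute)
  qed
  have \<phi>0: "\<phi> x = 0" if "x \<notin> S" for x
    using that far[of x] near[of x]
    by (auto simp: \<phi>_def S_def dist_norm norm_minus_commute intro!: bend_eq_0)
  have "Ck_on k (U \<union> - S) \<phi>" for k
  proof (rule Ck_on_Un)
    show "Ck_on k U \<phi>"
      using Ck_on_bend[OF U Cw] by (subst Ck_on_cong[OF U, where g = "\<lambda>x. bend (w x)"]) (auto simp: \<phi>_def)
    show "open (- S)" using S by (simp add: compact_imp_closed open_Compl)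
    then show "Ck_on k (- S) \<phi>"
      using \<phi>0 by (subst Ck_on_cong[where g = "\<lambda>x. 0"]) (auto simp: Ck_on_const)
  qed (rule U)
  moreover have "U \<union> - S = UNIV" using SU by auto
  ultimately have C\<phi>: "Ck_on k UNIV \<phi>" for k by metis
  have cl: "closure {x. \<phi> x \<noteq> 0} \<subseteq> S"
    using \<phi>0 S by (intro closure_minimal compact_imp_closed) auto
  have "compact (closure {x. \<phi> x \<noteq> 0})"
    using compact_Int_closed[OF S closed_closure, of "{x. \<phi> x \<noteq> 0}"] cl by (simp add: Int_absorb1)
  then have test: "test_function U \<phi>"
    unfolding test_function_def using C\<phi> cl SU by auto
  have \<phi>_pos: "\<phi> x \<ge> 0" for x by (simp add: \<phi>_def bend_nonneg)
  have p: "norm (p - x0) = 3 * r / 4" "norm (p - y) = R - r / 8"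
  proof -
    show "norm (p - x0) = 3 * r / 4" using y r by (simp add: p_def)
    have "p - y = (3 * r / 4 / norm (y - x0) - 1) *\<^sub>R (y - x0)" by (simp add: p_def algebra_simps)
    then have "norm (p - y) = \<bar>3 * r / 4 / norm (y - x0) - 1\<bar> * norm (y - x0)" by simp
    also have "\<dots> = (3 * r / 4 / norm (y - x0) - 1) * norm (y - x0)"
      using y r by (subst abs_of_nonneg) (auto simp: field_simps)
    also have "\<dots> = R - r / 8" using y by (simp add: R_def field_simps)
    finally show "norm (p - y) = R - r / 8" .
  qed
  have gain_ball: "norm (x - x0) < r" "r / 2 \<le> norm (x - x0)" "norm (x - y) \<le> R - r / 16" "3 * r / 16 \<le> norm (x - y)"
    if "x \<in> ball p (r / 16)" for x
  proof -
    have d: "norm (x - p) < r / 16" using that by (simp add: dist_norm norm_minus_commute)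
    have "norm (x - x0) \<le> norm (x - p) + norm (p - x0)" "norm (p - x0) \<le> norm (x - p) + norm (x - x0)"
      "norm (x - y) \<le> norm (x - p) + norm (p - y)" "norm (p - y) \<le> norm (x - p) + norm (x - y)"
      using norm_triangle_ineq[of "x - p" "p - x0"] norm_triangle_ineq[of "p - x" "x - x0"]
        norm_triangle_ineq[of "x - p" "p - y"] norm_triangle_ineq[of "p - x" "x - y"]
      by (auto simp: norm_minus_commute)
    then show "norm (x - x0) < r" "r / 2 \<le> norm (x - x0)" "norm (x - y) \<le> R - r / 16" "3 * r / 16 \<le> norm (x - y)"
      using d p R r by auto
  qed
  have gain: "gain_const n L / r\<^sup>2 \<le> flat [:0, 0, 0, 1:] (w x) * (norm (v x))\<^sup>2"
    if x: "x \<in> ball p (r / 16)" and xU: "x \<in> U" for x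
  proof -
    note gb = gain_ball[OF x]
    have E: "exp (- L) > 0" by simp
    have "(r / 2)\<^sup>2 \<le> t x" unfolding t(1) using gb r by (intro power_mono) auto
    then have "ln (r\<^sup>2 / 4) \<le> ln (t x)" using r tU(1)[OF xU] by (subst ln_le_cancel_iff) (auto simp: power_divide)
    moreover have "2 * M * sqrt (t x) \<ge> 0" using M tU[OF xU] by simp
    ultimately have "pole M (t x) \<le> X" unfolding pole_def X_def by linarith
    then have dpole: "\<delta> * pole M (t x) \<le> exp (- L) / 64"
      using mult_left_mono[of "pole M (t x)" X \<delta>] \<delta> by linarith
    have dpole0: "\<delta> * pole M (t x) \<ge> 0"
      using pole_lower(2)[OF tU[OF xU] M] M \<delta> by auto
    \<comment> \<open>The gap of at least \<open>r/16\<close> to the cut-off radius keeps \<open>w\<close> away from zero, where \<open>F''\<close> degenerates.\<close>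
    have RR: "(norm (x - y))\<^sup>2 \<le> R\<^sup>2 - r\<^sup>2 / 32"
    proof -
      have "(norm (x - y))\<^sup>2 \<le> (R - r / 16)\<^sup>2" using gb by (intro power_mono) auto
      also have "\<dots> = R\<^sup>2 - r / 16 * (2 * R - r / 16)" by (simp add: power2_eq_square algebra_simps)
      also have "\<dots> \<le> R\<^sup>2 - r / 16 * (r / 2)"
        using R r by (intro diff_left_mono mult_left_mono) auto
      finally show ?thesis by (simp add: power2_eq_square)
    qed
    have \<tau>T: "\<tau> x \<le> T" "r\<^sup>2 / 32 \<le> T - \<tau> x" "T - \<tau> x \<le> r\<^sup>2"
      using RR \<tau>(2)[of x] T(2) zero_le_power2[of r] by (auto simp: \<tau>(1) T_def)
    have qT: "exp (- L) / r ^ n \<le> q T" "exp (- L) / r ^ n \<le> q (\<tau> x)"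
      unfolding q_def using T \<tau>(2)[of x] \<tau>T r KL by (auto intro!: radial_slope_lower)
    have q\<tau>: "q (\<tau> x) \<le> exp (2 * real n) / (r / 8) ^ n"
    proof -
      have "(r / 8)\<^sup>2 \<le> (norm (x - y))\<^sup>2" using gb r by (intro power_mono) auto
      then have "(r / 8)\<^sup>2 \<le> \<tau> x" using \<tau>(1)[of x] zero_le_power2[of s] by linarith
      then show ?thesis unfolding q_def e_def using s \<tau>(3) r KL by (intro radial_slope_upper) auto
    qed
    note Qb = antiderivative_bounds[OF Q[unfolded q_def] \<tau>(2) \<tau>T(1) KL(2,3), folded q_def]
    have "(r\<^sup>2 / 32) * (exp (- L) / r ^ n) \<le> Q (\<tau> x) - Q T"
      by (rule order.trans[OF mult_mono Qb(1)]) (use \<tau>T qT r in auto)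
    from mult_left_mono[OF this, of lam] have H1: "exp (- L) / 32 \<le> lam * (Q (\<tau> x) - Q T)"
      using lam r by (simp add: lam_def field_simps)
    have "Q (\<tau> x) - Q T \<le> r\<^sup>2 * (exp (2 * real n) / (r / 8) ^ n)"
      by (rule order.trans[OF Qb(2) mult_mono]) (use \<tau>T q\<tau> r q_pos[OF \<tau>(2), of x] in auto)
    from mult_left_mono[OF this, of lam] have H2: "lam * (Q (\<tau> x) - Q T) \<le> 8 ^ n * exp (2 * real n)"
      using lam r by (simp add: lam_def power_divide field_simps)
    have F: "exp (- inverse (exp (- L) / 64)) / (8 ^ n * exp (2 * real n)) ^ 3 \<le> flat [:0, 0, 0, 1:] (w x)"
      by (rule bend_convex_lower) (use H1 H2 dpole dpole0 in \<open>auto simp: w\<close>)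
    have ng: "norm (x - x0) > 0" using gb r by linarith
    have "\<bar>g (t x)\<bar> = M / norm (x - x0) + 1 / (norm (x - x0))\<^sup>2"
    proof -
      have "g (t x) = - (M / norm (x - x0) + 1 / (norm (x - x0))\<^sup>2)"
        by (simp add: g_def pole_deriv_def t)
      moreover have "M / norm (x - x0) + 1 / (norm (x - x0))\<^sup>2 \<ge> 0" using M by simp
      ultimately show ?thesis by simp
    qed
    then have "\<bar>g (t x)\<bar> * norm (x - x0) = M + 1 / norm (x - x0)"
      using ng by (simp add: field_simps power2_eq_square)
    also have "\<dots> \<le> M + 2 / r"
    proof -
      have "1 / norm (x - x0) \<le> 1 / (r / 2)"
        using gb(2) r(1) ng by (intro divide_left_mono mult_pos_pos) auto
      then show ?thesis by simp
    qed
    also have "\<dots> \<le> (2 + M) / r"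
    proof -
      have "M \<le> M / r" using r M by (simp add: pos_le_divide_eq mult_left_le)
      then show ?thesis by (simp add: add_divide_distrib)
    qed
    finally have "2 * \<delta> * (\<bar>g (t x)\<bar> * norm (x - x0)) \<le> 2 * \<delta> * ((2 + M) / r)"
      using \<delta> by (intro mult_left_mono) auto
    also have "\<dots> = \<delta> * (4 + 2 * M) / r" by (simp add: algebra_simps)
    also have "\<dots> \<le> exp (- L) / 64 / r" using \<delta> r by (intro divide_right_mono) auto
    finally have v2: "norm ((2 * \<delta> * g (t x)) *\<^sub>R (x - x0)) \<le> exp (- L) / 64 / r"
      using \<delta> by (simp add: abs_mult mult.assoc)
    have "2 * lam * (exp (- L) / r ^ n) * (3 * r / 16) \<le> 2 * lam * q (\<tau> x) * norm (x - y)"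
      using lam qT gb r q_pos[OF \<tau>(2), of x] by (intro mult_mono) auto
    moreover have "2 * lam * (exp (- L) / r ^ n) * (3 * r / 16) = 3 / 8 * (exp (- L) / r)"
      using r by (simp add: lam_def field_simps power2_eq_square)
    ultimately have v1: "3 / 8 * (exp (- L) / r) \<le> norm ((- (2 * lam * q (\<tau> x))) *\<^sub>R (x - y))"
      using lam q_pos[OF \<tau>(2), of x] by (simp add: abs_mult)
    have "exp (- L) / 8 / r \<le> norm (v x)"
    proof -
      have "norm ((- (2 * lam * q (\<tau> x))) *\<^sub>R (x - y)) - norm ((2 * \<delta> * g (t x)) *\<^sub>R (x - x0)) \<le> norm (v x)"
        unfolding v_def by (rule norm_triangle_ineq2)
      moreover have "exp (- L) / r > 0" using r by simp
      ultimately show ?thesis using v1 v2 by (simp add: field_simps)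
    qed
    then have "(exp (- L) / 8 / r)\<^sup>2 \<le> (norm (v x))\<^sup>2" using r by (intro power_mono) auto
    then have "gain_const n L / r\<^sup>2 \<le> exp (- inverse (exp (- L) / 64)) / (8 ^ n * exp (2 * real n)) ^ 3 * (norm (v x))\<^sup>2"
      unfolding gain_const_def times_divide_eq_right[symmetric]
      by (intro mult_left_mono) (auto simp: power_divide)
    also have "\<dots> \<le> flat [:0, 0, 0, 1:] (w x) * (norm (v x))\<^sup>2"
      using F by (intro mult_right_mono) auto
    finally show ?thesis .
  qed
  have main: "- laplacian \<phi> x - (\<Sum>i\<in>UNIV. \<beta> $ i * partial_deriv i \<phi> x) + d * \<phi> x
         \<le> lam * (mass_const n M K / s ^ n) * indicator (ball y s) x
           - gain_const n L / r\<^sup>2 * indicator (ball p (r / 16)) x"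
    if x: "x \<in> U" and \<beta>: "norm \<beta> \<le> M" and d: "d \<le> K" for x \<beta> d
  proof -
    define f where "f = flat [:1, 1:] (w x)"
    define F2 where "F2 = flat [:0, 0, 0, 1:] (w x)"
    define \<rho> where "\<rho> = norm (x - y)"
    have \<rho>: "\<rho> \<ge> 0" "sqrt (\<rho>\<^sup>2) = \<rho>" "\<tau> x = \<rho>\<^sup>2 + s\<^sup>2" by (auto simp: \<rho>_def \<tau>)
    have f: "0 \<le> f" "f \<le> 1" unfolding f_def by (auto simp: bend_slope_nonneg bend_slope_le_1)
    have pd: "partial_deriv i \<phi> x = f * v x $ i" for i
    proof -
      have "partial_deriv i \<phi> x = partial_deriv i (\<lambda>x. bend (w x)) x"
        by (rule partial_deriv_cong[OF U x]) (simp add: \<phi>_def)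
      also have "\<dots> = f * partial_deriv i w x"
        unfolding f_def using w_der[OF x] bend_has_derivative
        by (intro partial_deriv_compose) (auto simp: differentiable_def)
      finally show ?thesis by (simp add: w_pd[OF x])
    qed
    have lap: "laplacian \<phi> x = f * laplacian w x + F2 * (norm (v x))\<^sup>2"
    proof -
      have "laplacian \<phi> x = laplacian (\<lambda>x. bend (w x)) x"
        by (rule laplacian_cong[OF U x]) (simp add: \<phi>_def)
      also have "\<dots> = f * laplacian w x + F2 * (\<Sum>i\<in>UNIV. (partial_deriv i w x)\<^sup>2)"
        unfolding f_def F2_def
        by (rule laplacian_compose[OF U x Cw bend_has_derivative bend_second_derivative])
      finally show ?thesis by (simp add: w_pd[OF x] norm_sq_eq_sum)
    qed
    have "(\<Sum>i\<in>UNIV. \<beta> $ i * partial_deriv i \<phi> x) = f * (\<beta> \<bullet> v x)"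
      by (simp add: pd inner_vec_def sum_distrib_left mult_ac)
    moreover have "- (\<beta> \<bullet> v x) \<le> M * (2 * lam * q (\<tau> x) * \<rho> + 2 * \<delta> * \<bar>g (t x)\<bar> * sqrt (t x))"
    proof -
      have "- (\<beta> \<bullet> v x) \<le> norm \<beta> * norm (v x)" using Cauchy_Schwarz_ineq2[of \<beta> "v x"] by linarith
      also have "\<dots> \<le> M * norm (v x)" using \<beta> by (intro mult_right_mono) auto
      also have "norm (v x) \<le> norm ((- (2 * lam * q (\<tau> x))) *\<^sub>R (x - y)) + norm ((2 * \<delta> * g (t x)) *\<^sub>R (x - x0))"
        unfolding v_def by (rule norm_triangle_ineq4)
      also have "\<dots> = 2 * lam * q (\<tau> x) * \<rho> + 2 * \<delta> * \<bar>g (t x)\<bar> * sqrt (t x)"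
        using lam \<delta> q_pos[OF \<tau>(2), of x] by (simp add: abs_mult \<rho>_def t)
      finally show ?thesis using M by (simp add: mult_left_mono)
    qed
    from mult_left_mono[OF this f(1)]
    have "- (f * (\<beta> \<bullet> v x)) \<le> f * (M * (2 * lam * q (\<tau> x) * \<rho> + 2 * \<delta> * \<bar>g (t x)\<bar> * sqrt (t x)))" by simp
    \<comment> \<open>Convexity and \<open>F(0) = 0\<close> give \<open>F(w) \<le> F'(w) w\<close>, so the zero-order term carries the same factor
      \<open>F'(w)\<close> as the others.\<close>
    moreover have "d * \<phi> x \<le> f * (K * w x)"
    proof -
      have "d * \<phi> x \<le> K * \<phi> x" using d \<phi>_pos by (rule mult_right_mono)
      also have "\<dots> \<le> K * (f * w x)"
        using x KL bend_le[of "w x"] by (intro mult_left_mono) (auto simp: \<phi>_def f_def)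
      finally show ?thesis by (simp add: mult_ac)
    qed
    moreover define E where "E = 2 * real n * q (\<tau> x) + 4 * \<rho>\<^sup>2 * q' (\<tau> x) + 2 * M * \<rho> * q (\<tau> x) + K * (Q (\<tau> x) - Q T)"
    moreover define G where "G = 2 * real n * g (t x) + 4 * t x * pole_deriv2 M (t x)
           + 2 * M * sqrt (t x) * \<bar>g (t x)\<bar> - K * pole M (t x)"
    ultimately have "- laplacian \<phi> x - (\<Sum>i\<in>UNIV. \<beta> $ i * partial_deriv i \<phi> x) + d * \<phi> x
        \<le> f * (- laplacian w x) - F2 * (norm (v x))\<^sup>2
          + f * (M * (2 * lam * q (\<tau> x) * \<rho> + 2 * \<delta> * \<bar>g (t x)\<bar> * sqrt (t x))) + f * (K * w x)"
      unfolding lap by linarith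
    also have "\<dots> = f * (lam * E) + f * (\<delta> * G) - F2 * (norm (v x))\<^sup>2"
      unfolding w_lap[OF x] w E_def G_def \<rho>_def by (simp add: algebra_simps)
    also have "\<dots> \<le> f * (lam * E) - F2 * (norm (v x))\<^sup>2"
    proof -
      have "G \<le> 0" unfolding G_def g_def
        using pole_supersolution[OF tU[OF x] M _ K, of n] n2 by (simp add: n_def)
      then have "f * (\<delta> * G) \<le> 0" using f \<delta> by (simp add: mult_le_0_iff)
      then show ?thesis by simp
    qed
    also have "f * (lam * E) \<le> lam * (mass_const n M K / s ^ n) * indicator (ball y s) x"
    proof (cases "w x > 0")
      case False
      then have "f = 0" by (simp add: f_def flat_def)
      moreover have "mass_const n M K \<ge> 0" using M KL by (simp add: mass_const_def)
      ultimately show ?thesis using lam s by (simp add: indicator_def)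
    next
      case True
      \<comment> \<open>Where \<open>w > 0\<close> the point lies inside the cut-off radius, the only range in which the profile
        is controlled by its slope.\<close>
      then have "\<rho> < R" using far[OF x] by (force simp: \<rho>_def)
      then have \<tau>T: "\<tau> x \<le> T" unfolding \<rho>(3) T_def using \<rho> by (intro add_right_mono power_mono) auto
      have "Q (\<tau> x) - Q T \<le> 2 * sqrt (\<tau> x) * q (\<tau> x)"
        unfolding q_def using n2 by (intro antiderivative_le[OF Q[unfolded q_def] \<tau>(2) \<tau>T T(3) _ KL(2,3)]) (auto simp: n_def)
      from mult_left_mono[OF this KL(1)]
      have E: "E \<le> 2 * real n * q (\<tau> x) + 4 * \<rho>\<^sup>2 * q' (\<tau> x) + 2 * M * sqrt (\<rho>\<^sup>2) * q (\<tau> x)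
          + K * (2 * sqrt (\<rho>\<^sup>2 + s\<^sup>2) * q (\<tau> x))"
        unfolding E_def \<rho>(2) \<rho>(3)[symmetric] by linarith
      have \<tau>1: "\<rho>\<^sup>2 + s\<^sup>2 \<le> 1" using \<tau>T T(3) \<rho>(3) by linarith
      note sub = radial_slope_subsolution[OF s(1) zero_le_power2 M KL(1) \<tau>1, of n,
          folded L_def e_def, folded q_def q'_def \<rho>(3)]
      show ?thesis
      proof (cases "x \<in> ball y s")
        case True
        have "q (\<tau> x) \<le> exp (2 * real n) / s ^ n"
          unfolding q_def e_def using s \<tau>(3) KL by (intro radial_slope_upper) auto
        then have "(2 * real n + 2 * M + 2 * K) * q (\<tau> x) \<le> (2 * real n + 2 * M + 2 * K) * (exp (2 * real n) / s ^ n)"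
          using M KL by (intro mult_left_mono) auto
        then have "E \<le> mass_const n M K / s ^ n"
          using E sub(1) by (simp add: mass_const_def \<rho>(3))
        then have "f * (lam * E) \<le> f * (lam * (mass_const n M K / s ^ n))"
          using f lam by (intro mult_left_mono) auto
        also have "\<dots> \<le> 1 * (lam * (mass_const n M K / s ^ n))"
          using f lam M KL s by (intro mult_right_mono) (auto simp: mass_const_def)
        finally show ?thesis using True by simp
      next
        case False
        then have "s \<le> \<rho>" by (simp add: \<rho>_def dist_norm norm_minus_commute)
        then have "s\<^sup>2 \<le> \<rho>\<^sup>2" using s by (intro power_mono) auto
        from sub(2)[OF this] E have "E \<le> 0" by (simp add: \<rho>(3))
        then have "f * (lam * E) \<le> 0" using f lam by (simp add: mult_le_0_iff)
        then show ?thesis using False by simp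
      qed
    qed
    finally have "- laplacian \<phi> x - (\<Sum>i\<in>UNIV. \<beta> $ i * partial_deriv i \<phi> x) + d * \<phi> x
        \<le> lam * (mass_const n M K / s ^ n) * indicator (ball y s) x - F2 * (norm (v x))\<^sup>2" by simp
    moreover have "gain_const n L / r\<^sup>2 * indicator (ball p (r / 16)) x \<le> F2 * (norm (v x))\<^sup>2"
      using gain[OF _ x] bend_convex by (auto simp: F2_def indicator_def)
    ultimately show ?thesis by linarith
  qed
  show thesis
  proof (rule that[of \<phi> p])
    show "ball p (r / 16) \<subseteq> ball x0 r - ball x0 (r / 2)"
      using gain_ball by (force simp: dist_norm norm_minus_commute)
  qed (use test \<phi>_pos main in \<open>auto simp: U_def n_def L_def lam_def\<close>)
qed

section \<open>From averages over small balls to an almost everywhere bound\<close>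

text \<open>Almost all of an open set is a countable disjoint union of balls on which the integral is known
to be nonnegative.\<close>
lemma nonneg_integral_open:
  fixes v :: "'a::euclidean_space \<Rightarrow> real"
  assumes "open D" and int: "set_integrable lebesgue D v"
    and ball: "\<And>y. y \<in> D \<Longrightarrow> \<exists>\<epsilon>>0. \<forall>s. 0 < s \<longrightarrow> s < \<epsilon> \<longrightarrow> 0 \<le> (LINT x:ball y s|lebesgue. v x)"
  shows "0 \<le> (LINT x:D|lebesgue. v x)"
proof -
  define K where "K = {(y, s). y \<in> D \<and> 0 < s \<and> ball y s \<subseteq> D \<and> 0 \<le> (LINT x:ball y s|lebesgue. v x)}"
  have cover: "\<exists>i. i \<in> K \<and> x \<in> ball (fst i) (snd i) \<and> snd i < d" if xd: "x \<in> D" "0 < d" for x d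
  proof -
    obtain \<epsilon> where \<epsilon>: "\<epsilon> > 0" "\<And>s. 0 < s \<Longrightarrow> s < \<epsilon> \<Longrightarrow> 0 \<le> (LINT x:ball x s|lebesgue. v x)"
      using ball[OF xd(1)] by blast
    obtain \<eta> where \<eta>: "\<eta> > 0" "ball x \<eta> \<subseteq> D" using assms(1) xd(1) openE by blast
    define s where "s = min (min \<epsilon> \<eta>) d / 2"
    have "0 < s" "s < \<epsilon>" "s < \<eta>" "s < d" using \<epsilon>(1) \<eta>(1) xd(2) by (auto simp: s_def)
    moreover from this have "ball x s \<subseteq> D" using \<eta>(2) subset_ball[of s \<eta> x] by (meson less_imp_le order_trans)
    ultimately show ?thesis using xd \<epsilon>(2) by (intro exI[of _ "(x, s)"]) (auto simp: K_def)
  qed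
  obtain C where C: "countable C" "C \<subseteq> K"
     "pairwise (\<lambda>i j. disjnt (ball (fst i) (snd i)) (ball (fst j) (snd j))) C"
     "negligible (D - (\<Union>i \<in> C. ball (fst i) (snd i)))"
    by (rule Vitali_covering_theorem_balls[OF cover])
  define A where "A k = (if k \<in> to_nat_on C ` C then ball (fst (from_nat_into C k)) (snd (from_nat_into C k)) else {})"
    for k
  have AC: "(\<Union>k. A k) = (\<Union>i \<in> C. ball (fst i) (snd i))"
    using C(1) by (force simp: A_def split: if_splits)
  have AD: "(\<Union>k. A k) \<subseteq> D" unfolding AC
  proof (rule UN_least)
    show "ball (fst i) (snd i) \<subseteq> D" if "i \<in> C" for i
      using subsetD[OF C(2) that] by (cases i) (simp add: K_def)
  qed
  have A_open: "open (A k)" for k by (simp add: A_def)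
  have disj: "A j \<inter> A k = {}" if "j \<noteq> k" for j k
  proof (cases "j \<in> to_nat_on C ` C \<and> k \<in> to_nat_on C ` C")
    case True
    then obtain a b where ab: "a \<in> C" "b \<in> C" "j = to_nat_on C a" "k = to_nat_on C b" by blast
    then have "a \<noteq> b" using that by auto
    then have "disjnt (ball (fst a) (snd a)) (ball (fst b) (snd b))"
      using C(3) ab by (auto simp: pairwise_def)
    then show ?thesis using ab C(1) by (simp add: A_def disjnt_def)
  qed (auto simp: A_def)
  have A_int: "set_integrable lebesgue (\<Union>k. A k) v"
    by (rule set_integrable_subset[OF int _ AD]) (auto intro!: borel_open A_open open_UN)
  have "AE x in lebesgue. x \<notin> D - (\<Union>k. A k)"
    using C(4) unfolding AC negligible_iff_null_sets by (rule AE_not_in)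
  then have "(LINT x:D|lebesgue. v x) = (LINT x:(\<Union>k. A k)|lebesgue. v x)"
    using AD A_open assms(1)
    by (intro set_integral_cong_set[symmetric])
       (use int A_int in \<open>auto simp: set_borel_measurable_def set_integrable_def\<close>)
  also have "\<dots> \<ge> 0"
  proof -
    define B where "B k = (\<Union>j\<in>{..<k}. A j)" for k
    have BA: "(\<Union>k. B k) = (\<Union>k. A k)" by (auto simp: B_def)
    have B: "B k \<in> sets lebesgue" for k unfolding B_def using A_open by auto
    have A_int': "set_integrable lebesgue (A k) v" for k
      by (rule set_integrable_subset[OF A_int]) (use A_open in auto)
    have A0: "0 \<le> (LINT x:A k|lebesgue. v x)" for k
    proof (cases "k \<in> to_nat_on C ` C")
      case True
      then obtain a where "a \<in> C" "k = to_nat_on C a" by blast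
      then have "A k = ball (fst a) (snd a)" "a \<in> K" using C(1,2) by (auto simp: A_def)
      then show ?thesis by (auto simp: K_def)
    qed (simp add: A_def set_lebesgue_integral_def)
    have "(LINT x:B k|lebesgue. v x) = (\<Sum>j<k. LINT x:A j|lebesgue. v x)" for k
      unfolding B_def using disj A_int' A_open
      by (intro set_integral_finite_Union) (auto simp: disjoint_family_on_def)
    then have B0: "0 \<le> (LINT x:B k|lebesgue. v x)" for k using A0 by (simp add: sum_nonneg)
    have "incseq B" unfolding incseq_def B_def by (auto; force)
    then have "(\<lambda>k. LINT x:B k|lebesgue. v x) \<longlonglongrightarrow> (LINT x:(\<Union>k. B k)|lebesgue. v x)"
      using A_int B by (intro set_integral_cont_up) (auto simp: BA)
    then show ?thesis unfolding BA using B0 by (intro LIMSEQ_le_const) auto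
  qed
  finally show ?thesis .
qed

text \<open>The set \<open>A\<close> where \<open>v < 0\<close> is, up to a null set, a decreasing intersection of open sets. The integral of
\<open>v\<close> is nonnegative over each of these, hence over \<open>A\<close>, so \<open>A\<close> is null.\<close>
lemma AE_nonneg_of_ball_integrals:
  fixes v :: "'a::euclidean_space \<Rightarrow> real"
  assumes "open D" and int: "set_integrable lebesgue D v"
    and ball: "\<And>y. y \<in> D \<Longrightarrow> \<exists>\<epsilon>>0. \<forall>s. 0 < s \<longrightarrow> s < \<epsilon> \<longrightarrow> 0 \<le> (LINT x:ball y s|lebesgue. v x)"
  shows "AE x\<in>D in lebesgue. 0 \<le> v x"
proof -
  define A where "A = {x \<in> D. v x < 0}"
  have D: "D \<in> sets lebesgue" using assms(1) by auto
  have vm: "(\<lambda>x. indicator D x *\<^sub>R v x) \<in> borel_measurable lebesgue"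
    using int unfolding set_integrable_def by simp
  have "A = {x \<in> space lebesgue. indicator D x *\<^sub>R v x < 0}"
    by (auto simp: A_def indicator_def)
  also have "\<dots> \<in> sets lebesgue" using vm by measurable
  finally have A: "A \<in> sets lebesgue" .
  have AD: "A \<subseteq> D" by (auto simp: A_def)
  obtain C N where CN: "gdelta C" "N \<in> null_sets lebesgue" "A \<union> N = C" "disjnt A N"
    using lebesgue_set_almost_gdelta[OF A] by blast
  then obtain F :: "nat \<Rightarrow> 'a set" where F: "\<And>k. open (F k)" "C = (\<Inter>k. F k)"
    by (auto elim!: gdelta.cases)
  define G where "G k = D \<inter> (\<Inter>j\<in>{..k}. F j)" for k
  have G_open: "open (G k)" for k unfolding G_def using assms(1) F by (intro open_Int open_INT) auto
  have GD: "G k \<subseteq> D" for k by (auto simp: G_def)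
  have Gint: "set_integrable lebesgue (G k) v" for k
    by (rule set_integrable_subset[OF int _ GD]) (use G_open in auto)
  have "decseq G" unfolding decseq_def G_def by (auto; force)
  from set_integral_cont_down[OF _ this Gint]
  have lim: "(\<lambda>k. LINT x:G k|lebesgue. v x) \<longlonglongrightarrow> (LINT x:(\<Inter>k. G k)|lebesgue. v x)"
    using G_open by auto
  have "0 \<le> (LINT x:G k|lebesgue. v x)" for k
    by (rule nonneg_integral_open[OF G_open Gint]) (use ball GD in blast)
  then have "0 \<le> (LINT x:(\<Inter>k. G k)|lebesgue. v x)"
    using lim by (intro LIMSEQ_le_const[OF lim]) auto
  also have "(\<Inter>k. G k) = D \<inter> (A \<union> N)"
    unfolding CN(3) F(2) G_def by auto
  also have "(LINT x:D \<inter> (A \<union> N)|lebesgue. v x) = (LINT x:A|lebesgue. v x)"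
  proof (rule set_integral_cong_set)
    show "set_borel_measurable lebesgue A v"
      using set_integrable_subset[OF int A AD] by (auto simp: set_borel_measurable_def set_integrable_def)
    have "D \<inter> (A \<union> N) \<in> sets lebesgue" using D A CN(2) by (auto intro!: sets.Int sets.Un)
    from set_integrable_subset[OF int this] show "set_borel_measurable lebesgue (D \<inter> (A \<union> N)) v"
      by (auto simp: set_borel_measurable_def set_integrable_def)
    show "AE x in lebesgue. (x \<in> A) = (x \<in> D \<inter> (A \<union> N))"
      using AE_not_in[OF CN(2)] by eventually_elim (use AD in auto)
  qed
  finally have nonneg: "0 \<le> (LINT x:A|lebesgue. v x)" .
  have Aint: "integrable lebesgue (\<lambda>x. indicator A x *\<^sub>R v x)"
    using set_integrable_subset[OF int A AD] by (simp add: set_integrable_def)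
  have le0: "indicator A x *\<^sub>R v x \<le> 0" for x by (auto simp: A_def indicator_def)
  have "integral\<^sup>L lebesgue (\<lambda>x. - (indicator A x *\<^sub>R v x)) = 0"
    using nonneg le0 integral_nonneg_AE[where M = lebesgue and f = "\<lambda>x. - (indicator A x *\<^sub>R v x)"]
    by (auto simp: set_lebesgue_integral_def intro!: antisym)
  then have "AE x in lebesgue. - (indicator A x *\<^sub>R v x) = 0"
    using integral_nonneg_eq_0_iff_AE[where M = lebesgue and f = "\<lambda>x. - (indicator A x *\<^sub>R v x)"] Aint le0 by auto
  then show ?thesis by eventually_elim (force simp: A_def indicator_def split: if_splits)
qed

section \<open>Integrating against test functions\<close>

lemma set_integrable_mult_compact_support:
  fixes u f :: "real ^ 'n::finite \<Rightarrow> real"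
  assumes "compact S" "S \<subseteq> U" "u locally_integrable_on U" "continuous_on S f"
    and "\<And>x. x \<in> U \<Longrightarrow> x \<notin> S \<Longrightarrow> f x = 0"
  shows "set_integrable lebesgue U (\<lambda>x. u x * f x)"
proof -
  have S: "S \<in> sets lebesgue" using assms(1) by (simp add: compact_imp_closed borel_closed)
  have "(\<lambda>x. f x * u x) absolutely_integrable_on S"
  proof (rule absolutely_integrable_bounded_measurable_product[OF bilinear_times])
    show "f \<in> borel_measurable (lebesgue_on S)"
      by (rule continuous_imp_measurable_on_sets_lebesgue[OF assms(4) S])
    show "bounded (f ` S)" by (rule compact_imp_bounded[OF compact_continuous_image[OF assms(4,1)]])
    show "u absolutely_integrable_on S" using assms(1-3) by (auto simp: locally_integrable_on_def)
  qed (rule S)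
  then have "integrable lebesgue (\<lambda>x. indicator S x *\<^sub>R (f x * u x))" by (simp add: set_integrable_def)
  moreover have "(\<lambda>x. indicator S x *\<^sub>R (f x * u x)) = (\<lambda>x. indicator U x *\<^sub>R (u x * f x))"
    using assms(2,5) by (intro ext) (auto simp: indicator_def)
  ultimately show ?thesis by (simp only: set_integrable_def)
qed

text \<open>The difference quotients have integral zero by translation invariance, and they converge
dominatedly.\<close>
lemma integral_partial_deriv_eq_0:
  fixes f :: "real ^ 'n::finite \<Rightarrow> real"
  assumes "Ck_on (Suc 0) UNIV f" "compact S" "\<And>x. x \<notin> S \<Longrightarrow> f x = 0"
  shows "integrable lborel (partial_deriv i f)" "integral\<^sup>L lborel (partial_deriv i f) = 0"
proof -
  have fd: "f differentiable (at x)" and pc: "continuous_on UNIV (partial_deriv i f)" for x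
    using assms(1) by auto
  have fc: "continuous_on UNIV f" by (rule Ck_on_continuous[OF assms(1)])
  have der: "((\<lambda>h. f (x + h *\<^sub>R axis i 1)) has_real_derivative partial_deriv i f (x + h *\<^sub>R axis i 1)) (at h)" for x h
  proof -
    have "((\<lambda>h. x + h *\<^sub>R axis i 1) has_derivative (\<lambda>k. k *\<^sub>R axis i 1)) (at h)"
      by (auto intro!: derivative_eq_intros)
    from has_derivative_compose[OF this fd[unfolded frechet_derivative_works]]
    have "((\<lambda>h. f (x + h *\<^sub>R axis i 1)) has_derivative
        (\<lambda>k. frechet_derivative f (at (x + h *\<^sub>R axis i 1)) (k *\<^sub>R axis i 1))) (at h)" .
    moreover have "frechet_derivative f (at (x + h *\<^sub>R axis i 1)) (k *\<^sub>R axis i 1)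
        = partial_deriv i f (x + h *\<^sub>R axis i 1) * k" for k
      unfolding partial_deriv_def
      using linear_frechet_derivative[OF fd] by (simp add: linear_cmul)
    ultimately show ?thesis by (simp add: has_field_derivative_def)
  qed
  have p0: "partial_deriv i f x = 0" if "x \<notin> S" for x
    by (rule partial_deriv_zero_outside[OF compact_imp_closed[OF assms(2)] assms(3) that])
  obtain B where B: "B > 0" "\<And>x. \<bar>partial_deriv i f x\<bar> \<le> B"
  proof -
    have "bounded (partial_deriv i f ` S)"
      by (rule compact_imp_bounded[OF compact_continuous_image[OF continuous_on_subset[OF pc] assms(2)]]) auto
    then obtain B where "B > 0" "\<forall>y \<in> partial_deriv i f ` S. norm y \<le> B" by (auto simp: bounded_pos)
    then have "\<bar>partial_deriv i f x\<bar> \<le> B" for x using p0[of x] by (cases "x \<in> S") auto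
    then show thesis using that \<open>B > 0\<close> by blast
  qed
  obtain \<rho> where \<rho>: "\<rho> > 0" "\<And>x. x \<in> S \<Longrightarrow> norm x \<le> \<rho>"
    using compact_imp_bounded[OF assms(2)] by (auto simp: bounded_pos)
  have lip: "\<bar>f (x + h *\<^sub>R axis i 1) - f x\<bar> \<le> h * B" if h: "h > 0" for x h
  proof -
    obtain z where "f (x + h *\<^sub>R axis i 1) - f x = h * partial_deriv i f (x + z *\<^sub>R axis i 1)"
      using MVT2[OF h der[of x]] by auto
    then show ?thesis using B(2) h by (simp add: abs_mult)
  qed
  define D where "D k x = (f (x + inverse (Suc k) *\<^sub>R axis i 1) - f x) / inverse (Suc k)" for k x
  have fint: "integrable lborel f"
  proof -
    have "integrable lborel (\<lambda>x. indicator S x *\<^sub>R f x)"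
      by (rule borel_integrable_compact[OF assms(2) continuous_on_subset[OF fc]]) auto
    moreover have "(\<lambda>x. indicator S x *\<^sub>R f x) = f" using assms(3) by (auto simp: indicator_def fun_eq_iff)
    ultimately show ?thesis by simp
  qed
  have fm [measurable]: "f \<in> borel_measurable borel" by (rule borel_measurable_continuous_onI[OF fc])
  have shift: "integrable lborel (\<lambda>x. f (x + a))" "(LINT x|lborel. f (x + a)) = (LINT x|lborel. f x)" for a
  proof -
    have "integrable (distr lborel borel ((+) a)) f" using fint by (simp add: lborel_distr_plus)
    then show "integrable lborel (\<lambda>x. f (x + a))" by (subst (asm) integrable_distr_eq) (auto simp: add.commute)
    have "(LINT x|lborel. f x) = (LINT x|distr lborel borel ((+) a). f x)" by (simp add: lborel_distr_plus)
    also have "\<dots> = (LINT x|lborel. f (x + a))"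
      using fint by (subst integral_distr) (auto simp: add.commute)
    finally show "(LINT x|lborel. f (x + a)) = (LINT x|lborel. f x)" by simp
  qed
  have D0: "integral\<^sup>L lborel (D k) = 0" for k
    unfolding D_def[abs_def] using shift fint by simp
  have Dint: "integrable lborel (D k)" for k
    unfolding D_def[abs_def] using shift fint by simp
  have lim: "(\<lambda>k. D k x) \<longlonglongrightarrow> partial_deriv i f x" for x
  proof -
    have "((\<lambda>h. (f (x + h *\<^sub>R axis i 1) - f x) / h) \<longlongrightarrow> partial_deriv i f x) (at 0)"
      using der[of x 0] by (simp add: has_field_derivative_iff)
    moreover have "filterlim (\<lambda>k. inverse (real (Suc k))) (at 0) sequentially"
      using LIMSEQ_inverse_real_of_nat by (auto simp: filterlim_at)
    ultimately show ?thesis unfolding D_def by (rule filterlim_compose)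
  qed
  have bound: "norm (D k x) \<le> B * indicator (cball 0 (\<rho> + 1)) x" for k x
  proof (cases "norm x \<le> \<rho> + 1")
    case True
    define h where "h = inverse (real (Suc k))"
    have "h > 0" by (simp add: h_def)
    then have "\<bar>(f (x + h *\<^sub>R axis i 1) - f x) / h\<bar> \<le> B"
      using lip[of h x] by (simp add: abs_divide pos_divide_le_eq mult.commute)
    then show ?thesis using True by (simp add: D_def h_def)
  next
    case False
    have "norm (inverse (real (Suc k)) *\<^sub>R (axis i 1 :: real ^ 'n)) \<le> 1"
      by (simp add: inverse_eq_divide)
    then have "norm (x + inverse (real (Suc k)) *\<^sub>R axis i 1) > \<rho>"
      using False norm_diff_ineq[of x "inverse (real (Suc k)) *\<^sub>R axis i 1"] by linarith
    then have "x + inverse (real (Suc k)) *\<^sub>R axis i 1 \<notin> S" "x \<notin> S" using False \<rho> by fastforce+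
    then show ?thesis using assms(3) B by (simp add: D_def)
  qed
  have dom: "integrable lborel (\<lambda>x :: real^'n. B * indicator (cball 0 (\<rho> + 1)) x)"
    by (intro integrable_mult_right integrable_real_indicator) (use emeasure_lborel_cball_finite[of 0 "\<rho> + 1"] in auto)
  have pm: "partial_deriv i f \<in> borel_measurable lborel"
    using borel_measurable_continuous_onI[OF pc] by simp
  show "integrable lborel (partial_deriv i f)"
    by (rule integrable_dominated_convergence[OF pm _ dom, of D]) (use lim bound Dint in auto)
  have "(\<lambda>k. integral\<^sup>L lborel (D k)) \<longlonglongrightarrow> integral\<^sup>L lborel (partial_deriv i f)"
    by (rule integral_dominated_convergence[OF pm _ dom]) (use lim bound Dint in auto)
  then show "integral\<^sup>L lborel (partial_deriv i f) = 0"
    unfolding D0 using LIMSEQ_unique tendsto_const by blast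
qed

lemma test_functionD:
  fixes \<phi> :: "real ^ 'n::finite \<Rightarrow> real"
  assumes "test_function U \<phi>"
  defines "S \<equiv> closure {x. \<phi> x \<noteq> 0}"
  shows "Ck_on k UNIV \<phi>" "\<phi> differentiable (at x)" "compact S" "S \<subseteq> U"
    "x \<notin> S \<Longrightarrow> \<phi> x = 0" "x \<notin> S \<Longrightarrow> partial_deriv i \<phi> x = 0" "x \<notin> S \<Longrightarrow> laplacian \<phi> x = 0"
    "continuous_on V \<phi>" "continuous_on V (partial_deriv i \<phi>)" "continuous_on V (laplacian \<phi>)"
proof -
  show C: "Ck_on k UNIV \<phi>" for k
    using assms by (simp add: test_function_def)
  show "compact S" "S \<subseteq> U"
    using assms by (simp_all add: test_function_def)
  show "\<phi> differentiable (at x)" using C[of "Suc 0"] by simp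
  have S: "closed S" unfolding S_def by simp
  show 0: "\<phi> x = 0" if "x \<notin> S" for x
    using that closure_subset[of "{x. \<phi> x \<noteq> 0}"] unfolding S_def by blast
  show 1: "partial_deriv i \<phi> x = 0" if "x \<notin> S" for x i
    by (rule partial_deriv_zero_outside[OF S 0 that])
  show "laplacian \<phi> x = 0" if "x \<notin> S" for x
    using partial_deriv_zero_outside[OF S 1 that] by (simp add: laplacian_def)
  show "continuous_on V \<phi>" using Ck_on_subset[OF C[of 0] subset_UNIV] by simp
  show "continuous_on V (partial_deriv i \<phi>)" for i
    using Ck_on_subset[OF C[of "Suc 0"] subset_UNIV] by simp
  have "continuous_on V (partial_deriv i (partial_deriv i \<phi>))" for i
    using Ck_on_subset[OF C[of "Suc (Suc 0)"] subset_UNIV] by simp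
  then show "continuous_on V (laplacian \<phi>)"
    unfolding laplacian_def[abs_def] by (intro continuous_on_sum)
qed

lemma integral_laplacian_eq_0:
  fixes \<phi> :: "real ^ 'n::finite \<Rightarrow> real"
  assumes "test_function U \<phi>" "U \<in> sets lebesgue"
  shows "set_integrable lebesgue U (laplacian \<phi>)" "(LINT x:U|lebesgue. laplacian \<phi> x) = 0"
proof -
  note T = test_functionD[OF assms(1)]
  have 1: "Ck_on (Suc 0) UNIV (partial_deriv i \<phi>)" for i
    using T(1)[of "Suc (Suc 0)"] by simp
  note I = integral_partial_deriv_eq_0[OF 1 T(3) T(6)]
  have L: "integrable lborel (laplacian \<phi>)" "integral\<^sup>L lborel (laplacian \<phi>) = 0"
    unfolding laplacian_def[abs_def] using I by simp_all
  have "(\<lambda>x. indicator U x *\<^sub>R laplacian \<phi> x) = laplacian \<phi>"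
    using T(4,7) by (force simp: indicator_def fun_eq_iff)
  then show "set_integrable lebesgue U (laplacian \<phi>)" "(LINT x:U|lebesgue. laplacian \<phi> x) = 0"
    unfolding set_integrable_def set_lebesgue_integral_def
    using L borel_measurable_integrable[OF L(1)]
    by (simp_all add: integrable_completion integral_completion)
qed

lemma partial_deriv_component:
  fixes b :: "real ^ 'n::finite \<Rightarrow> real ^ 'm::finite"
  assumes "b differentiable (at x)"
  shows "partial_deriv i (\<lambda>y. b y $ j) x = partial_deriv i b x $ j"
    and "(\<lambda>y. b y $ j) differentiable (at x)"
proof -
  note d = bounded_linear.has_derivative[OF bounded_linear_vec_nth[of j]
      assms[unfolded frechet_derivative_works]]
  show "partial_deriv i (\<lambda>y. b y $ j) x = partial_deriv i b x $ j"
    using partial_deriv_eq[OF d] by (simp add: partial_deriv_def)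
  show "(\<lambda>y. b y $ j) differentiable (at x)" using d unfolding differentiable_def by blast
qed

lemma divergence_scaleR:
  assumes "\<phi> differentiable (at x)" "b differentiable (at x)"
  shows "divergence (\<lambda>y. \<phi> y *\<^sub>R b y) x
           = \<phi> x * divergence b x + (\<Sum>i\<in>UNIV. b x $ i * partial_deriv i \<phi> x)"
proof -
  have "partial_deriv i (\<lambda>y. (\<phi> y *\<^sub>R b y) $ i) x
      = \<phi> x * partial_deriv i (\<lambda>y. b y $ i) x + b x $ i * partial_deriv i \<phi> x" for i
    using partial_deriv_mult[OF assms(1) partial_deriv_component(2)[OF assms(2), of i], of i]
    by (simp add: mult.commute)
  then show ?thesis by (simp add: divergence_def sum.distrib sum_distrib_left)
qed

lemma divergence_bound:
  fixes b :: "real ^ 'n::finite \<Rightarrow> real ^ 'n" and M :: real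
  assumes "b differentiable (at x)" "onorm (frechet_derivative b (at x)) \<le> M"
  shows "\<bar>divergence b x\<bar> \<le> real CARD('n) * M"
proof -
  have bl: "bounded_linear (frechet_derivative b (at x))"
    using assms(1) frechet_derivative_works has_derivative_bounded_linear by blast
  have "\<bar>partial_deriv i (\<lambda>y. b y $ i) x\<bar> \<le> M" for i
  proof -
    have "\<bar>partial_deriv i b x $ i\<bar> \<le> norm (partial_deriv i b x)"
      by (rule component_le_norm_cart)
    also have "\<dots> \<le> onorm (frechet_derivative b (at x)) * norm (axis i 1 :: real ^ 'n)"
      unfolding partial_deriv_def by (rule onorm[OF bl])
    finally show ?thesis using assms(2) by (simp add: partial_deriv_component(1)[OF assms(1)])
  qed
  then have "(\<Sum>i\<in>UNIV. \<bar>partial_deriv i (\<lambda>y. b y $ i) x\<bar>) \<le> (\<Sum>i\<in>(UNIV :: 'n set). M)"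
    by (intro sum_mono)
  then show ?thesis
    unfolding divergence_def by (intro order.trans[OF sum_abs]) simp
qed

lemma C1_norm_bounds:
  assumes "C1_norm V b \<le> ennreal M" "M \<ge> 0" "x \<in> V"
  shows "norm (b x) \<le> M" "onorm (frechet_derivative b (at x)) \<le> M"
proof -
  have "ennreal (norm (b x)) \<le> (SUP x\<in>V. ennreal (norm (b x)))"
    "ennreal (onorm (frechet_derivative b (at x))) \<le> (SUP x\<in>V. ennreal (onorm (frechet_derivative b (at x))))"
    using assms(3) by (auto intro: SUP_upper)
  then have "ennreal (norm (b x)) \<le> ennreal M" "ennreal (onorm (frechet_derivative b (at x))) \<le> ennreal M"
    using assms(1) unfolding C1_norm_def
    by (meson add_increasing add_increasing2 order_trans zero_le order_refl)+
  then show "norm (b x) \<le> M" "onorm (frechet_derivative b (at x)) \<le> M"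
    using assms(2) by (simp_all add: ennreal_le_iff)
qed

lemma integrable_adjoint:
  fixes b :: "real ^ 'n::finite \<Rightarrow> real ^ 'n"
  assumes "Ck_on 1 U b" "u locally_integrable_on U" "test_function U \<phi>"
  shows "set_integrable lebesgue U (\<lambda>x. u x * (- laplacian \<phi> x - divergence (\<lambda>y. \<phi> y *\<^sub>R b y) x + k * \<phi> x))"
proof -
  define S where "S = closure {x. \<phi> x \<noteq> 0}"
  note T = test_functionD[OF assms(3), folded S_def]
  have bd: "x \<in> U \<Longrightarrow> b differentiable (at x)" "continuous_on U (partial_deriv i b)" for x i
    using assms(1) by auto
  have bc: "continuous_on S b"
    using Ck_on_continuous[OF assms(1)] T(4) continuous_on_subset by blast
  have bpc: "continuous_on S (partial_deriv i b)" for i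
    using bd(2) T(4) continuous_on_subset by blast
  have div: "divergence (\<lambda>y. \<phi> y *\<^sub>R b y) x
      = \<phi> x * (\<Sum>i\<in>UNIV. partial_deriv i b x $ i) + (\<Sum>i\<in>UNIV. b x $ i * partial_deriv i \<phi> x)" if "x \<in> U" for x
    using divergence_scaleR[OF T(2) bd(1)[OF that]] partial_deriv_component(1)[OF bd(1)[OF that]]
    by (simp add: divergence_def)
  show ?thesis
  proof (rule set_integrable_mult_compact_support[OF T(3,4) assms(2)])
    have "continuous_on S (\<lambda>x. - laplacian \<phi> x - (\<phi> x * (\<Sum>i\<in>UNIV. partial_deriv i b x $ i)
        + (\<Sum>i\<in>UNIV. b x $ i * partial_deriv i \<phi> x)) + k * \<phi> x)"
      by (intro continuous_intros T(8-10) bc bpc)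
    then show "continuous_on S (\<lambda>x. - laplacian \<phi> x - divergence (\<lambda>y. \<phi> y *\<^sub>R b y) x + k * \<phi> x)"
      using div T(4) by (subst continuous_on_cong[OF refl]) auto
    show "- laplacian \<phi> x - divergence (\<lambda>y. \<phi> y *\<^sub>R b y) x + k * \<phi> x = 0" if "x \<in> U" "x \<notin> S" for x
      using that T(5-7) by (simp add: div)
  qed
qed

text \<open>Where \<open>u \<ge> 0\<close>, raising the potential only adds to the integral. This reduces the theorem to a
constant potential, for which \<open>u - a\<close> makes sense for every constant \<open>a\<close>: the product
\<open>c (u - a)\<close> need not be locally integrable in general.\<close>
lemma distributional_supersolution_increase_potential:
  fixes b :: "real ^ 'n::finite \<Rightarrow> real ^ 'n"
  assumes "Ck_on 1 U b" "u locally_integrable_on U" "(\<lambda>x. c x * u x) locally_integrable_on U"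
    and "\<And>x. x \<in> U \<Longrightarrow> c x \<le> M" "AE x\<in>U in lebesgue. u x \<ge> 0"
    and "distributional_supersolution U b c u"
  shows "distributional_supersolution U b (\<lambda>_. M) u"
  unfolding distributional_supersolution_def
proof (intro allI impI)
  fix \<phi> assume \<phi>: "test_function U \<phi> \<and> (\<forall>x. 0 \<le> \<phi> x)"
  note T = test_functionD[OF conjunct1[OF \<phi>]]
  let ?A = "\<lambda>x. - laplacian \<phi> x - divergence (\<lambda>y. \<phi> y *\<^sub>R b y) x"
  have i1: "set_integrable lebesgue U (\<lambda>x. u x * (?A x + M * \<phi> x))" for M
    by (rule integrable_adjoint[OF assms(1,2) conjunct1[OF \<phi>]])
  have i2: "set_integrable lebesgue U (\<lambda>x. (c x * u x) * \<phi> x)"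
    by (rule set_integrable_mult_compact_support[OF T(3,4) assms(3) T(8)]) (rule T(5))
  have i3: "set_integrable lebesgue U (\<lambda>x. u x * (?A x + c x * \<phi> x))"
    using set_integral_add(1)[OF i1[of 0] i2] by (simp add: algebra_simps)
  have "0 \<le> (LINT x:U|lebesgue. u x * (?A x + c x * \<phi> x))"
    using assms(6) \<phi> unfolding distributional_supersolution_def by blast
  also have "\<dots> \<le> (LINT x:U|lebesgue. u x * (?A x + M * \<phi> x))"
  proof (rule set_integral_mono_AE[OF i3 i1])
    show "AE x\<in>U in lebesgue. u x * (?A x + c x * \<phi> x) \<le> u x * (?A x + M * \<phi> x)"
      using assms(5)
    proof eventually_elim
      case (elim x)
      show ?case
      proof
        assume "x \<in> U"
        then have "c x * \<phi> x \<le> M * \<phi> x" "0 \<le> u x" using assms(4) \<phi> elim by (auto intro: mult_right_mono)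
        then show "u x * (?A x + c x * \<phi> x) \<le> u x * (?A x + M * \<phi> x)" by (intro mult_left_mono) auto
      qed
    qed
  qed
  finally show "0 \<le> (LINT x:U|lebesgue. u x * (?A x + M * \<phi> x))" .
qed

section \<open>The lower bound\<close>

text \<open>The minimum with \<open>1/2\<close> makes the bound valid in the outer shell as well, and leaves the iteration of
\<open>sharp_lower_bound\<close> a factor \<open>1 - \<alpha>\<close> that is strictly positive. The value \<open>K = (n + 1) M\<close> is the bound
for \<open>M - div b\<close>; \<open>16\<^sup>n\<close> is the ratio of the volumes of \<open>B\<^sub>r\<close> and of the ball of radius
\<open>r / 16\<close> on which the gain is collected.\<close>
definition lower_const :: "nat \<Rightarrow> real \<Rightarrow> real" where
  "lower_const n M = min (1 / 2)
     (gain_const n (2 * M + 2 * ((real n + 1) * M)) / (mass_const n M ((real n + 1) * M) * 16 ^ n))"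

lemma gain_const_pos: "gain_const n L > 0"
  by (simp add: gain_const_def)

lemma mass_const_pos: "n \<ge> 1 \<Longrightarrow> M \<ge> 0 \<Longrightarrow> K \<ge> 0 \<Longrightarrow> mass_const n M K > 0"
  by (simp add: mass_const_def add_pos_nonneg)

lemma lower_const_pos: "n \<ge> 1 \<Longrightarrow> M \<ge> 0 \<Longrightarrow> lower_const n M > 0"
  by (simp add: lower_const_def gain_const_pos mass_const_pos)

context
  fixes x0 :: "real ^ 'n::finite" and r M :: real and b :: "real ^ 'n \<Rightarrow> real ^ 'n"
    and m :: real and u :: "real ^ 'n \<Rightarrow> real"
  assumes n2: "CARD('n) \<ge> 2" and M: "M \<ge> 0" and r: "0 < r" "r \<le> 1"
    and bC: "Ck_on 1 (ball x0 r) b" and bM: "C1_norm (ball x0 r) b \<le> ennreal M"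
    and m: "m > 0" and u_int: "u locally_integrable_on (ball x0 r - {x0})"
    and super: "distributional_supersolution (ball x0 r - {x0}) b (\<lambda>_. M) u"
    and outer: "AE x\<in>ball x0 r - ball x0 (r / 2) in lebesgue. u x \<ge> m"
    and u_pos: "AE x\<in>ball x0 r in lebesgue. u x \<ge> 0"
begin

lemma cball_subset_punctured_ball:
  assumes "norm (y - x0) < r / 2" "s \<le> r / 8" "s < norm (y - x0)"
  shows "cball y s \<subseteq> ball x0 r - {x0}"
proof
  fix x assume "x \<in> cball y s"
  then have "dist y x \<le> s" by simp
  moreover have "dist x0 x \<le> dist y x0 + dist y x" "dist y x0 = norm (y - x0)"
    using dist_triangle[of x0 x y] by (simp_all add: dist_commute) (simp add: dist_norm norm_minus_commute)
  ultimately show "x \<in> ball x0 r - {x0}" using assms r by auto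
qed

lemma integrable_on_ball:
  assumes "norm (y - x0) < r / 2" "s \<le> r / 8" "s < norm (y - x0)"
  shows "set_integrable lebesgue (ball y s) u"
proof -
  have "set_integrable lebesgue (cball y s) u"
    using u_int cball_subset_punctured_ball[OF assms] by (auto simp: locally_integrable_on_def)
  then show ?thesis by (rule set_integrable_subset) auto
qed

text \<open>The adjoint inequality tested with the barrier. The powers of \<open>r\<close> cancel, which is why the constant
does not depend on \<open>r\<close>; that of \<open>s\<close> is absorbed by the volume of the ball.\<close>
lemma ball_average_lower_bound:
  assumes y: "norm (y - x0) < r / 2" and s: "0 < s" "s \<le> r / 8" "s < norm (y - x0)"
  shows "lower_const CARD('n) M * m * measure lebesgue (ball y s) \<le> (LINT x:ball y s|lebesgue. u x)"
proof -
  define n where "n = CARD('n)"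
  define U where "U = ball x0 r - {x0}"
  define K where "K = (real n + 1) * M"
  define C where "C = r ^ n / r\<^sup>2 * (mass_const n M K / s ^ n)"
  define g where "g = gain_const n (2 * M + 2 * K)"
  have n1: "n \<ge> 1" using n2 by (simp add: n_def)
  have K: "K \<ge> 2 * M" "K \<ge> 0" unfolding K_def using n1 M by (auto intro!: mult_right_mono)
  have mc: "mass_const n M K > 0" using mass_const_pos n1 M K by simp
  have "y \<noteq> x0" using s by auto
  from barrier_test_function[OF n2 M K(1) r this y s(1,2), folded n_def, folded U_def C_def g_def]
  obtain \<phi> p where \<phi>: "test_function U \<phi>" "\<And>x. \<phi> x \<ge> 0"
    and p: "ball p (r / 16) \<subseteq> ball x0 r - ball x0 (r / 2)"
    and bound: "\<And>x \<beta> d. x \<in> U \<Longrightarrow> norm \<beta> \<le> M \<Longrightarrow> d \<le> K \<Longrightarrow>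
       - laplacian \<phi> x - (\<Sum>i\<in>UNIV. \<beta> $ i * partial_deriv i \<phi> x) + d * \<phi> x
         \<le> C * indicator (ball y s) x - g / r\<^sup>2 * indicator (ball p (r / 16)) x" by blast
  have U_ball: "U \<subseteq> ball x0 r" by (auto simp: U_def)
  have bCU: "Ck_on 1 U b"
    by (rule Ck_on_subset[OF bC U_ball])
  have pU: "ball p (r / 16) \<subseteq> U" using p r by (force simp: U_def)
  have yU: "ball y s \<subseteq> U"
    unfolding U_def by (rule order_trans[OF ball_subset_cball cball_subset_punctured_ball[OF y s(2,3)]])
  let ?A = "\<lambda>x. - laplacian \<phi> x - divergence (\<lambda>y. \<phi> y *\<^sub>R b y) x + M * \<phi> x"
  have A: "?A x \<le> C * indicator (ball y s) x - g / r\<^sup>2 * indicator (ball p (r / 16)) x" if x: "x \<in> U" for x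
  proof -
    have xb: "x \<in> ball x0 r" using x U_ball by auto
    have bd: "b differentiable (at x)" using bC xb by auto
    note bb = C1_norm_bounds[OF bM M xb]
    have "M - divergence b x \<le> K"
      using divergence_bound[OF bd bb(2)] by (simp add: K_def n_def algebra_simps)
    from bound[OF x bb(1) this] show ?thesis
      by (simp add: divergence_scaleR[OF test_functionD(2)[OF \<phi>(1)] bd] algebra_simps)
  qed
  have u_ball: "set_integrable lebesgue (ball y s) u" by (rule integrable_on_ball[OF y s(2,3)])
  have B_eq: "(\<lambda>x. indicator U x *\<^sub>R (C * (indicator (ball y s) x * u x) - m * g / r\<^sup>2 * indicator (ball p (r / 16)) x))
      = (\<lambda>x. C * (indicator (ball y s) x *\<^sub>R u x) - m * g / r\<^sup>2 * indicator (ball p (r / 16)) x)"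
  proof (rule ext)
    fix x
    have "x \<notin> U \<Longrightarrow> x \<notin> ball y s \<and> x \<notin> ball p (r / 16)" using yU pU by blast
    then show "indicator U x *\<^sub>R (C * (indicator (ball y s) x * u x) - m * g / r\<^sup>2 * indicator (ball p (r / 16)) x)
      = C * (indicator (ball y s) x *\<^sub>R u x) - m * g / r\<^sup>2 * indicator (ball p (r / 16)) x"
      by (cases "x \<in> U") (simp_all del: mem_ball)
  qed
  have iy: "integrable lebesgue (\<lambda>x. indicator (ball y s) x *\<^sub>R u x)"
    using u_ball by (simp add: set_integrable_def)
  have ip: "integrable lebesgue (indicator (ball p (r / 16)) :: real ^ 'n \<Rightarrow> real)"
    using lmeasurable_ball[of p "r / 16"] by (simp only: lmeasurable_iff_integrable)
  have B_int: "set_integrable lebesgue U (\<lambda>x. C * (indicator (ball y s) x * u x) - m * g / r\<^sup>2 * indicator (ball p (r / 16)) x)"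
    unfolding set_integrable_def B_eq using iy ip by (intro Bochner_Integration.integrable_diff integrable_mult_right) auto
  have "0 \<le> (LINT x:U|lebesgue. u x * ?A x)"
    using super \<phi> unfolding distributional_supersolution_def U_def by blast
  also have "\<dots> \<le> (LINT x:U|lebesgue. C * (indicator (ball y s) x * u x) - m * g / r\<^sup>2 * indicator (ball p (r / 16)) x)"
  proof (rule set_integral_mono_AE[OF integrable_adjoint[OF bCU u_int[folded U_def] \<phi>(1)] B_int])
    show "AE x\<in>U in lebesgue. u x * ?A x
        \<le> C * (indicator (ball y s) x * u x) - m * g / r\<^sup>2 * indicator (ball p (r / 16)) x"
      using outer u_pos
    proof eventually_elim
      case (elim x)
      show ?case
      proof
        assume x: "x \<in> U"
        have "0 \<le> u x" using elim x U_ball by auto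
        then have "u x * ?A x \<le> u x * (C * indicator (ball y s) x - g / r\<^sup>2 * indicator (ball p (r / 16)) x)"
          using A[OF x] by (rule mult_left_mono[rotated])
        also have "\<dots> = C * (indicator (ball y s) x * u x) - u x * (g / r\<^sup>2 * indicator (ball p (r / 16)) x)"
          by (simp add: algebra_simps)
        also have "\<dots> \<le> C * (indicator (ball y s) x * u x) - m * (g / r\<^sup>2 * indicator (ball p (r / 16)) x)"
        proof (cases "x \<in> ball p (r / 16)")
          case True
          then have "m \<le> u x" using elim p by auto
          then have "m * (g / r\<^sup>2) \<le> u x * (g / r\<^sup>2)"
            using gain_const_pos by (intro mult_right_mono) (auto simp: g_def less_imp_le)
          then show ?thesis using True by simp
        qed simp
        finally show "u x * ?A x
          \<le> C * (indicator (ball y s) x * u x) - m * g / r\<^sup>2 * indicator (ball p (r / 16)) x" by simp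
      qed
    qed
  qed
  also have "\<dots> = C * (LINT x:ball y s|lebesgue. u x) - m * g / r\<^sup>2 * measure lebesgue (ball p (r / 16))"
    unfolding set_lebesgue_integral_def B_eq using iy ip
    by (subst Bochner_Integration.integral_diff) auto
  finally have 1: "m * g / r\<^sup>2 * measure lebesgue (ball p (r / 16)) \<le> C * (LINT x:ball y s|lebesgue. u x)"
    by simp
  define V where "V = unit_ball_vol (real n)"
  have V: "measure lebesgue (ball p (r / 16)) = V * (r / 16) ^ n" "measure lebesgue (ball y s) = V * s ^ n"
    using r s content_ball[of "r / 16" p] content_ball[of s y] by (simp_all add: V_def n_def)
  have V0: "V > 0" by (simp add: V_def)
  have "m * g / r\<^sup>2 * (V * (r / 16) ^ n) = (r ^ n / r\<^sup>2) * (m * (g / 16 ^ n) * V)"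
    by (simp add: power_divide)
  with 1 have "(r ^ n / r\<^sup>2) * (m * (g / 16 ^ n) * V)
      \<le> (r ^ n / r\<^sup>2) * (mass_const n M K / s ^ n * (LINT x:ball y s|lebesgue. u x))"
    unfolding V C_def by (simp add: mult.assoc)
  then have "m * (g / 16 ^ n) * V \<le> mass_const n M K / s ^ n * (LINT x:ball y s|lebesgue. u x)"
    using r by (subst (asm) mult_le_cancel_left_pos) auto
  then have "g / (mass_const n M K * 16 ^ n) * m * (V * s ^ n) \<le> (LINT x:ball y s|lebesgue. u x)"
    using mc s(1) by (simp add: field_simps)
  moreover have "lower_const n M * (m * (V * s ^ n)) \<le> g / (mass_const n M K * 16 ^ n) * (m * (V * s ^ n))"
    using m V0 s(1) by (intro mult_right_mono) (auto simp: lower_const_def g_def K_def)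
  ultimately show ?thesis unfolding V n_def[symmetric] by (simp add: mult.assoc)
qed

text \<open>The shells \<open>D k\<close> exhaust the punctured inner ball and stay away from \<open>x0\<close>, near which \<open>u\<close> is not
known to be integrable.\<close>
lemma lower_bound: "AE x\<in>ball x0 r in lebesgue. u x \<ge> lower_const CARD('n) M * m"
proof -
  define a where "a = lower_const CARD('n) M * m"
  define D where "D k = ball x0 (r / 2) - cball x0 (r / real (k + 3))" for k :: nat
  have "AE x\<in>D k in lebesgue. 0 \<le> u x - a" for k
  proof (rule AE_nonneg_of_ball_integrals)
    show D: "open (D k)" by (auto simp: D_def intro: open_Diff)
    have ca: "set_integrable lebesgue (ball y s) (\<lambda>_. a)" for y s
      using lmeasurable_ball[of y s] by (simp add: set_integrable_def lmeasurable_iff_integrable)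
    have "cball x0 (r / 2) - ball x0 (r / real (k + 3)) \<subseteq> ball x0 r - {x0}" using r by auto
    then have "u absolutely_integrable_on (cball x0 (r / 2) - ball x0 (r / real (k + 3)))"
      using u_int by (auto simp: locally_integrable_on_def compact_diff)
    then have "set_integrable lebesgue (D k) u"
      by (rule set_integrable_subset) (use D in \<open>auto simp: D_def\<close>)
    moreover have "set_integrable lebesgue (D k) (\<lambda>_. a)"
      by (rule set_integrable_subset[OF ca[of x0 "r / 2"]]) (use D in \<open>auto simp: D_def\<close>)
    ultimately show "set_integrable lebesgue (D k) (\<lambda>x. u x - a)" by simp
    fix y assume "y \<in> D k"
    then have y: "norm (y - x0) < r / 2" "0 < norm (y - x0)"
      using r by (auto simp: D_def dist_norm norm_minus_commute)
    show "\<exists>\<epsilon>>0. \<forall>s>0. s < \<epsilon> \<longrightarrow> 0 \<le> (LINT x:ball y s|lebesgue. u x - a)"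
    proof (intro exI[of _ "min (r / 8) (norm (y - x0))"] conjI allI impI)
      fix s assume s: "0 < s" "s < min (r / 8) (norm (y - x0))"
      have "(LINT x:ball y s|lebesgue. u x - a) = (LINT x:ball y s|lebesgue. u x) - (LINT x:ball y s|lebesgue. a)"
        by (rule set_integral_diff(2)[OF integrable_on_ball[OF y(1)] ca]) (use s in auto)
      also have "(LINT x:ball y s|lebesgue. a) = a * measure lebesgue (ball y s)"
        by (simp add: set_lebesgue_integral_def mult.commute)
      finally show "0 \<le> (LINT x:ball y s|lebesgue. u x - a)"
        using ball_average_lower_bound[OF y(1) s(1)] s by (simp add: a_def)
    qed (use y r in auto)
  qed
  then have "AE x in lebesgue. \<forall>k. x \<in> D k \<longrightarrow> 0 \<le> u x - a" by (subst AE_all_countable) blast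
  moreover have "AE x in lebesgue. x \<notin> {x0}"
    by (rule AE_not_in) (simp flip: negligible_iff_null_sets)
  ultimately show ?thesis
    using outer
  proof eventually_elim
    case (elim x)
    show ?case
    proof
      assume x: "x \<in> ball x0 r"
      show "lower_const CARD('n) M * m \<le> u x"
      proof (cases "x \<in> ball x0 (r / 2)")
        case True
        have "dist x0 x > 0" using elim by auto
        then obtain k :: nat where k: "r / dist x0 x < real k" using reals_Archimedean2 by blast
        have "r < real k * dist x0 x" using k \<open>dist x0 x > 0\<close> by (simp add: pos_divide_less_eq)
        also have "\<dots> \<le> real (k + 3) * dist x0 x" by (intro mult_right_mono) auto
        finally have "x \<in> D k" using True by (simp add: D_def field_simps)
        then show ?thesis using elim by (auto simp: a_def)
      next
        case False
        then have "m \<le> u x" using elim x by auto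
        moreover have "lower_const CARD('n) M * m \<le> 1 * m"
          using m by (intro mult_right_mono) (auto simp: lower_const_def)
        ultimately show ?thesis by simp
      qed
    qed
  qed
qed

end

text \<open>Without drift the adjoint operator is \<open>- \<Delta>\<phi>\<close>, which integrates to zero.\<close>
lemma distributional_supersolution_minus_const:
  fixes u :: "real ^ 'n::finite \<Rightarrow> real"
  assumes "U \<in> sets lebesgue" "Ck_on 1 U b" "\<And>x. x \<in> U \<Longrightarrow> b x = 0" "open U"
    and "u locally_integrable_on U" "distributional_supersolution U b (\<lambda>_. 0) u"
  shows "distributional_supersolution U b (\<lambda>_. 0) (\<lambda>x. u x - a)"
  unfolding distributional_supersolution_def
proof (intro allI impI)
  fix \<phi> assume \<phi>: "test_function U \<phi> \<and> (\<forall>x. 0 \<le> \<phi> x)"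
  let ?A = "\<lambda>x. - laplacian \<phi> x - divergence (\<lambda>y. \<phi> y *\<^sub>R b y) x + 0 * \<phi> x"
  note I = integral_laplacian_eq_0[OF conjunct1[OF \<phi>] assms(1)]
  have A: "?A x = - laplacian \<phi> x" if "x \<in> U" for x
  proof -
    have "partial_deriv i (\<lambda>y. (\<phi> y *\<^sub>R b y) $ i) x = partial_deriv i (\<lambda>_. 0) x" for i
      by (rule partial_deriv_cong[OF assms(4) that]) (simp add: assms(3))
    then show ?thesis by (simp add: divergence_def partial_deriv_eq[OF has_derivative_const])
  qed
  have uA: "set_integrable lebesgue U (\<lambda>x. u x * ?A x)"
    by (rule integrable_adjoint[OF assms(2,5) conjunct1[OF \<phi>]])
  have "(LINT x:U|lebesgue. (u x - a) * ?A x) = (LINT x:U|lebesgue. u x * ?A x + a * laplacian \<phi> x)"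
    unfolding set_lebesgue_integral_def
    by (rule Bochner_Integration.integral_cong[OF refl]) (use A in \<open>auto simp: indicator_def algebra_simps\<close>)
  also have "\<dots> = (LINT x:U|lebesgue. u x * ?A x)"
    using uA I by (subst set_integral_add) auto
  also have "\<dots> \<ge> 0" using assms(6) \<phi> unfolding distributional_supersolution_def by blast
  finally show "0 \<le> (LINT x:U|lebesgue. (u x - a) * ?A x)" .
qed

text \<open>If \<open>u \<ge> a\<close> is known for some \<open>a < m\<close>, then \<open>u - a\<close> satisfies the hypotheses with
\<open>m - a\<close> in place of \<open>m\<close>, so that \<open>m\<close> minus the bound shrinks by the factor \<open>1 - \<alpha>\<close> at each step.\<close>
lemma sharp_lower_bound:
  fixes x0 :: "real ^ 'n::finite" and r :: real and b :: "real ^ 'n \<Rightarrow> real ^ 'n"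
    and m :: real and u :: "real ^ 'n \<Rightarrow> real"
  assumes n2: "CARD('n) \<ge> 2" and r: "0 < r" "r \<le> 1"
    and bC: "Ck_on 1 (ball x0 r) b" and bM: "C1_norm (ball x0 r) b \<le> ennreal 0"
    and m: "m > 0" and u_int: "u locally_integrable_on (ball x0 r - {x0})"
    and super: "distributional_supersolution (ball x0 r - {x0}) b (\<lambda>_. 0) u"
    and outer: "AE x\<in>ball x0 r - ball x0 (r / 2) in lebesgue. u x \<ge> m"
    and u_pos: "AE x\<in>ball x0 r in lebesgue. u x \<ge> 0"
  shows "AE x\<in>ball x0 r in lebesgue. u x \<ge> m"
proof -
  define \<alpha> where "\<alpha> = lower_const CARD('n) 0"
  define U where "U = ball x0 r - {x0}"
  have \<alpha>: "0 < \<alpha>" "\<alpha> \<le> 1 / 2"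
    using lower_const_pos[of "CARD('n)" 0] n2 unfolding \<alpha>_def
    by (simp_all only: lower_const_def min.cobounded1)
  have U: "open U" "U \<in> sets lebesgue" by (auto simp: U_def intro: open_Diff)
  have b0: "b x = 0" if "x \<in> U" for x
    using C1_norm_bounds(1)[OF bM _] that by (auto simp: U_def)
  have bCU: "Ck_on 1 U b" by (rule Ck_on_subset[OF bC]) (auto simp: U_def)
  have step: "AE x\<in>ball x0 r in lebesgue. u x \<ge> (1 - (1 - \<alpha>) ^ k) * m" for k :: nat
  proof (induction k)
    case 0
    then show ?case using u_pos by simp
  next
    case (Suc k)
    define a where "a = (1 - (1 - \<alpha>) ^ k) * m"
    have const_int: "(\<lambda>_. a) absolutely_integrable_on C" if "compact C" for C :: "(real ^ 'n) set"
      using that by (simp add: absolutely_integrable_on_const lmeasurable_compact)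
    have "AE x\<in>ball x0 r in lebesgue. u x - a \<ge> \<alpha> * ((1 - \<alpha>) ^ k * m)"
    proof (rule lower_bound[OF n2 order_refl r bC bM, folded \<alpha>_def])
      show "0 < (1 - \<alpha>) ^ k * m" using \<alpha> m by simp
      show "(\<lambda>x. u x - a) locally_integrable_on (ball x0 r - {x0})"
        using u_int const_int by (auto simp: locally_integrable_on_def)
      show "distributional_supersolution (ball x0 r - {x0}) b (\<lambda>_. 0) (\<lambda>x. u x - a)"
        using distributional_supersolution_minus_const[OF U(2) bCU b0 U(1)] u_int super by (simp add: U_def)
      show "AE x\<in>ball x0 r - ball x0 (r / 2) in lebesgue. u x - a \<ge> (1 - \<alpha>) ^ k * m"
        using outer by eventually_elim (auto simp: a_def algebra_simps)
      show "AE x\<in>ball x0 r in lebesgue. u x - a \<ge> 0"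
        using Suc by eventually_elim (auto simp: a_def)
    qed
    then show ?case by eventually_elim (auto simp: a_def algebra_simps)
  qed
  have lim: "(\<lambda>k. (1 - (1 - \<alpha>) ^ k) * m) \<longlonglongrightarrow> (1 - 0) * m"
    using \<alpha> by (intro tendsto_intros LIMSEQ_realpow_zero) auto
  have "AE x in lebesgue. \<forall>k. x \<in> ball x0 r \<longrightarrow> u x \<ge> (1 - (1 - \<alpha>) ^ k) * m"
    using step by (subst AE_all_countable) blast
  then show ?thesis
  proof eventually_elim
    case (elim x)
    then show ?case using LIMSEQ_le_const2[OF lim, of "u x"] by auto
  qed
qed

theorem theorem1p4:
  fixes M :: real
  assumes "CARD('n::finite) \<ge> 2" and "M \<ge> 0"
  shows "\<exists>\<alpha>::real. \<alpha> > 0 \<and> (M = 0 \<longrightarrow> \<alpha> = 1) \<and>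
    (\<forall>(x0 :: real ^ 'n) (r::real) (b :: real ^ 'n \<Rightarrow> real ^ 'n) (c :: real ^ 'n \<Rightarrow> real)
        (m::real) (u :: real ^ 'n \<Rightarrow> real).
      0 < r \<longrightarrow> r \<le> 1 \<longrightarrow>
      Ck_on 1 (ball x0 r) b \<longrightarrow> C1_norm (ball x0 r) b \<le> ennreal M \<longrightarrow>
      c \<in> borel_measurable (lebesgue_on (ball x0 r)) \<longrightarrow> (\<forall>x\<in>ball x0 r. c x \<le> M) \<longrightarrow>
      m > 0 \<longrightarrow>
      u locally_integrable_on (ball x0 r - {x0}) \<longrightarrow>
      (\<lambda>x. c x * u x) locally_integrable_on (ball x0 r - {x0}) \<longrightarrow>
      distributional_supersolution (ball x0 r - {x0}) b c u \<longrightarrow>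
      (AE x\<in>ball x0 r - ball x0 (r / 2) in lebesgue. u x \<ge> m) \<longrightarrow>
      (AE x\<in>ball x0 r in lebesgue. u x \<ge> 0) \<longrightarrow>
      (AE x\<in>ball x0 r in lebesgue. u x \<ge> \<alpha> * m))"
proof (intro exI[of _ "if M = 0 then 1 else lower_const CARD('n) M"] conjI allI impI)
  show "(if M = 0 then 1 else lower_const CARD('n) M) > 0"
    using lower_const_pos assms by simp
next
  fix x0 :: "real ^ 'n" and r :: real and b :: "real ^ 'n \<Rightarrow> real ^ 'n" and c :: "real ^ 'n \<Rightarrow> real"
    and m :: real and u :: "real ^ 'n \<Rightarrow> real"
  assume r: "0 < r" "r \<le> 1" and b: "Ck_on 1 (ball x0 r) b" "C1_norm (ball x0 r) b \<le> ennreal M"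
    and c: "\<forall>x\<in>ball x0 r. c x \<le> M" and m: "m > 0"
    and u: "u locally_integrable_on (ball x0 r - {x0})"
      "(\<lambda>x. c x * u x) locally_integrable_on (ball x0 r - {x0})"
      "distributional_supersolution (ball x0 r - {x0}) b c u"
    and outer: "AE x\<in>ball x0 r - ball x0 (r / 2) in lebesgue. u x \<ge> m"
    and pos: "AE x\<in>ball x0 r in lebesgue. u x \<ge> 0"
  have bU: "Ck_on 1 (ball x0 r - {x0}) b"
    by (rule Ck_on_subset[OF b(1)]) auto
  have super: "distributional_supersolution (ball x0 r - {x0}) b (\<lambda>_. M) u"
    by (rule distributional_supersolution_increase_potential[OF bU u(1,2) _ _ u(3)])
       (use c pos in \<open>auto elim: eventually_mono\<close>)
  show "AE x\<in>ball x0 r in lebesgue. u x \<ge> (if M = 0 then 1 else lower_const CARD('n) M) * m"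
  proof (cases "M = 0")
    case True
    then show ?thesis
      using sharp_lower_bound[OF assms(1) r b(1) _ m u(1) _ outer pos] b(2) super by simp
  next
    case False
    then show ?thesis
      using lower_bound[OF assms r b m u(1) super outer pos] by simp
  qed
qed simp

end
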